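(* Let $(\mathcal N,P,h)$ be a 2-dimensional almost paracomplex Riemannian manifold and let $(\mathcal C(\mathcal N),\phi,\xi,\eta,g)$ be the 3-dimensional apapR manifold with $\mathcal C(\mathcal N)=\mathbb R^+\times\mathcal N$, $g\big((x',a\tfrac{d}{dt}),(y',b\tfrac{d}{dt})\big)=t^2h(x',y')+ab$, $\phi(x',a\tfrac{d}{dt})=(Px',0)$, $\xi=\tfrac{d}{dt}$, $\eta=dt$. Then $(\mathcal C(\mathcal N),\phi,\xi,\eta,g)$: (1) belongs to $\mathcal F_1\oplus\mathcal F_5$; (2) belongs to $\mathcal F_5$ if and only if $(\mathcal N,P,h)$ is a $\mathcal W_0$-manifold; (3) cannot belong to $\mathcal F_1$.
   Context: An almost paracomplex Riemannian manifold $(\mathcal N,P,h)$ of dimension $2n$ is a differentiable manifold with an endomorphism $P$ of $T\mathcal N$ satisfying $P^2=I$, $P\neq I$, $\operatorname{tr}P=0$ (the eigenvalues $\pm1$ have the same multiplicity $n$) and a Riemannian metric $h$ with $h(Px',Py')=h(x',y')$. Let $\nabla'$ be the Levi-Civita connection of $h$; $(\mathcal N,P,h)$ is called a $\mathcal W_0$-manifold if $\nabla'P=0$. An almost paracontact almost paracomplex Riemannian manifold (apapR manifold) $(\mathcal M,\phi,\xi,\eta,g)$ is a $(2n+1)$-dimensional differentiable manifold with an endomorphism $\phi$ of $T\mathcal M$, a vector field $\xi$, a 1-form $\eta$ and a Riemannian metric $g$ such that $\phi^2=\mathcal I-\eta\otimes\xi$, $\eta(\xi)=1$, $\eta\circ\phi=0$,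 $\phi\xi=0$, $\operatorname{tr}\phi=0$, $g(\phi x,\phi y)=g(x,y)-\eta(x)\eta(y)$. Its fundamental tensor is $F(x,y,z)=g((\nabla_x\phi)y,z)$, where $\nabla$ is the Levi-Civita connection of $g$. For $\dim\mathcal M=3$, a $\phi$-basis $\{e_0,e_1,e_2\}$ of $T_p\mathcal M$ is an orthonormal basis with $e_0=\xi$, $\phi e_0=0$, $\phi e_1=e_2$, $\phi e_2=e_1$ (so $\eta(e_0)=1$, $\eta(e_1)=\eta(e_2)=0$). Put $F_{ijk}=F(e_i,e_j,e_k)$, $\theta(z)=\sum_{i=1}^{2}F(e_i,e_i,z)$, $\theta^*(z)=\sum_{i=1}^{2}F(e_i,\phi e_i,z)$, $\theta_k=\theta(e_k)$, $\theta^*_k=\theta^*(e_k)$; thus $\theta_1=F_{111}=-F_{122}$, $\theta_2=F_{222}=-F_{211}$, $\theta^*_0=F_{120}+F_{210}$. For $x=x^ie_i$, $y=y^ie_i$, $z=z^ie_i$ define $$F^1(x,y,z)=(x^1\theta_1-x^2\theta_2)(y^1z^1-y^2z^2),$$ $$F^5(x,y,z)=\tfrac12\theta^*_0\{x^1(y^0z^2+y^2z^0)+x^2(y^0z^1+y^1z^0)\}.$$ A 3-dimensional apapR manifold belongs to the class $\mathcal F_1$ (resp. $\mathcal F_5$, resp. $\mathcal F_1\oplus\mathcal F_5$) if and only if $F=F^1$ (resp. $F=F^5$, resp. $F=F^1+F^5$) at every point. $\mathbb R^+$ is the set of positive reals, $t$ is its coordinate; tangent vectors of $\mathbb R^+\times\mathcal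 N$ are written $(x',a\tfrac{d}{dt})$ with $x'$ tangent to $\mathcal N$. *)

theory Defs
  imports "HOL-Analysis.Analysis"
begin

section \<open>Smooth maps between open subsets of Euclidean spaces\<close>

fun Ck_on :: "nat \<Rightarrow> ('e::euclidean_space \<Rightarrow> 'f::euclidean_space) \<Rightarrow> 'e set \<Rightarrow> bool" where
  "Ck_on 0 f S \<longleftrightarrow> continuous_on S f"
| "Ck_on (Suc k) f S \<longleftrightarrow> (\<forall>x\<in>S. f differentiable (at x)) \<and>
     (\<forall>v. Ck_on k (\<lambda>x. frechet_derivative f (at x) v) S)"

definition smooth_on :: "'e set \<Rightarrow> ('e::euclidean_space \<Rightarrow> 'f::euclidean_space) \<Rightarrow> bool" where
  "smooth_on S f \<longleftrightarrow> open S \<and> (\<forall>k. Ck_on k f S)"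

section \<open>Smooth manifolds\<close>

text \<open>
  A manifold modelled on the Euclidean space \<open>'e\<close> is given by an indexed smooth atlas
  \<open>(U\<^sub>i, c\<^sub>i)\<close>, \<open>i \<in> I\<close>.  Its underlying space is the union of the chart domains, an open
  subset of a second countable Hausdorff space; its dimension is \<open>DIM('e)\<close>.
\<close>

record ('i, 'a, 'e) manifold =
  Idx :: "'i set"
  Dom :: "'i \<Rightarrow> 'a set"
  Crd :: "'i \<Rightarrow> 'a \<Rightarrow> 'e"

definition carrier :: "('i, 'a, 'e) manifold \<Rightarrow> 'a set" where
  "carrier M = (\<Union>i\<in>Idx M. Dom M i)"

definition Img :: "('i, 'a, 'e) manifold \<Rightarrow> 'i \<Rightarrow> 'e set" where
  "Img M i = Crd M i ` Dom M i"

definition Overlap :: "('i, 'a, 'e) manifold \<Rightarrow> 'i \<Rightarrow> 'i \<Rightarrow> 'e set" where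
  "Overlap M i j = Crd M i ` (Dom M i \<inter> Dom M j)"

definition transition :: "('i, 'a, 'e) manifold \<Rightarrow> 'i \<Rightarrow> 'i \<Rightarrow> 'e \<Rightarrow> 'e" where
  "transition M i j = Crd M j \<circ> inv_into (Dom M i) (Crd M i)"

definition smooth_manifold ::
  "('i, 'a::{t2_space,second_countable_topology}, 'e::euclidean_space) manifold \<Rightarrow> bool" where
  "smooth_manifold M \<longleftrightarrow>
     carrier M \<noteq> {} \<and>
     (\<forall>i\<in>Idx M. open (Dom M i) \<and> open (Img M i) \<and>
        homeomorphism (Dom M i) (Img M i) (Crd M i) (inv_into (Dom M i) (Crd M i))) \<and>
     (\<forall>i\<in>Idx M. \<forall>j\<in>Idx M. smooth_on (Overlap M i j) (transition M i j))"

section \<open>Tensor fields\<close>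

text \<open>
  In the chart \<open>i\<close> at the coordinate point \<open>x\<close> the tangent space is identified with \<open>'e\<close>, the
  vectors \<open>v\<close> in the chart \<open>i\<close> and \<open>D \<tau>\<^sub>i\<^sub>j(x) v\<close> in the chart \<open>j\<close> being the same tangent vector
  (\<open>\<tau>\<^sub>i\<^sub>j\<close> is the transition map).  A tensor field is given by its smooth representations in all
  charts, subject to the corresponding transformation law.
\<close>

type_synonym ('i, 'e) vec_field = "'i \<Rightarrow> 'e \<Rightarrow> 'e"
type_synonym ('i, 'e) one_form = "'i \<Rightarrow> 'e \<Rightarrow> 'e \<Rightarrow> real"
type_synonym ('i, 'e) endo_field = "'i \<Rightarrow> 'e \<Rightarrow> 'e \<Rightarrow> 'e"
type_synonym ('i, 'e) bilin_field = "'i \<Rightarrow> 'e \<Rightarrow> 'e \<Rightarrow> 'e \<Rightarrow> real"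

abbreviation dtransition :: "('i, 'a, 'e::euclidean_space) manifold \<Rightarrow> 'i \<Rightarrow> 'i \<Rightarrow> 'e \<Rightarrow> 'e \<Rightarrow> 'e" where
  "dtransition M i j x \<equiv> frechet_derivative (transition M i j) (at x)"

definition vector_field ::
  "('i, 'a, 'e::euclidean_space) manifold \<Rightarrow> ('i, 'e) vec_field \<Rightarrow> bool" where
  "vector_field M X \<longleftrightarrow>
     (\<forall>i\<in>Idx M. smooth_on (Img M i) (X i)) \<and>
     (\<forall>i\<in>Idx M. \<forall>j\<in>Idx M. \<forall>x\<in>Overlap M i j.
        X j (transition M i j x) = dtransition M i j x (X i x))"

definition one_form_field ::
  "('i, 'a, 'e::euclidean_space) manifold \<Rightarrow> ('i, 'e) one_form \<Rightarrow> bool" where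
  "one_form_field M \<eta> \<longleftrightarrow>
     (\<forall>i\<in>Idx M. \<forall>x\<in>Img M i. linear (\<eta> i x)) \<and>
     (\<forall>i\<in>Idx M. \<forall>v. smooth_on (Img M i) (\<lambda>x. \<eta> i x v)) \<and>
     (\<forall>i\<in>Idx M. \<forall>j\<in>Idx M. \<forall>x\<in>Overlap M i j. \<forall>v.
        \<eta> j (transition M i j x) (dtransition M i j x v) = \<eta> i x v)"

definition endomorphism_field ::
  "('i, 'a, 'e::euclidean_space) manifold \<Rightarrow> ('i, 'e) endo_field \<Rightarrow> bool" where
  "endomorphism_field M \<phi> \<longleftrightarrow>
     (\<forall>i\<in>Idx M. \<forall>x\<in>Img M i. linear (\<phi> i x)) \<and>
     (\<forall>i\<in>Idx M. \<forall>v. smooth_on (Img M i) (\<lambda>x. \<phi> i x v)) \<and>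
     (\<forall>i\<in>Idx M. \<forall>j\<in>Idx M. \<forall>x\<in>Overlap M i j. \<forall>v.
        \<phi> j (transition M i j x) (dtransition M i j x v) = dtransition M i j x (\<phi> i x v))"

definition riemannian_metric ::
  "('i, 'a, 'e::euclidean_space) manifold \<Rightarrow> ('i, 'e) bilin_field \<Rightarrow> bool" where
  "riemannian_metric M g \<longleftrightarrow>
     (\<forall>i\<in>Idx M. \<forall>x\<in>Img M i. bilinear (g i x) \<and>
        (\<forall>v w. g i x v w = g i x w v) \<and> (\<forall>v. v \<noteq> 0 \<longrightarrow> g i x v v > 0)) \<and>
     (\<forall>i\<in>Idx M. \<forall>v w. smooth_on (Img M i) (\<lambda>x. g i x v w)) \<and>
     (\<forall>i\<in>Idx M. \<forall>j\<in>Idx M. \<forall>x\<in>Overlap M i j. \<forall>v w.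
        g j (transition M i j x) (dtransition M i j x v) (dtransition M i j x w) = g i x v w)"

definition trace_endo :: "('e::euclidean_space \<Rightarrow> 'e) \<Rightarrow> real" where
  "trace_endo f = (\<Sum>b\<in>Basis. f b \<bullet> b)"

section \<open>The Levi-Civita connection\<close>

text \<open>
  Everything here takes place in one chart, with \<open>g\<close>, \<open>\<phi>\<close>, \<open>X\<close>, \<open>Y\<close>, \<open>Z\<close> the representations
  in that chart.  A connection is given at \<open>x\<close> by a bilinear map \<open>\<Gamma>\<close> (its Christoffel symbols),
  with \<open>\<nabla>\<^sub>u Y = D Y(x) u + \<Gamma>(u, Y(x))\<close>.
\<close>

definition nabla :: "('e \<Rightarrow> 'e \<Rightarrow> 'e) \<Rightarrow> 'e \<Rightarrow> 'e \<Rightarrow> ('e \<Rightarrow> 'e) \<Rightarrow> 'e::euclidean_space" where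
  "nabla \<Gamma> x u Y = frechet_derivative Y (at x) u + \<Gamma> u (Y x)"

definition lie_bracket :: "('e \<Rightarrow> 'e) \<Rightarrow> ('e \<Rightarrow> 'e) \<Rightarrow> 'e \<Rightarrow> 'e::euclidean_space" where
  "lie_bracket X Y x = frechet_derivative Y (at x) (X x) - frechet_derivative X (at x) (Y x)"

definition torsion_free_at :: "'e::euclidean_space \<Rightarrow> ('e \<Rightarrow> 'e \<Rightarrow> 'e) \<Rightarrow> bool" where
  "torsion_free_at x \<Gamma> \<longleftrightarrow>
     (\<forall>X Y. X differentiable (at x) \<longrightarrow> Y differentiable (at x) \<longrightarrow>
        nabla \<Gamma> x (X x) Y - nabla \<Gamma> x (Y x) X = lie_bracket X Y x)"

definition metric_compatible_at ::
  "('e \<Rightarrow> 'e \<Rightarrow> 'e \<Rightarrow> real) \<Rightarrow> 'e::euclidean_space \<Rightarrow> ('e \<Rightarrow> 'e \<Rightarrow> 'e) \<Rightarrow> bool" where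
  "metric_compatible_at g x \<Gamma> \<longleftrightarrow>
     (\<forall>u Y Z. Y differentiable (at x) \<longrightarrow> Z differentiable (at x) \<longrightarrow>
        frechet_derivative (\<lambda>y. g y (Y y) (Z y)) (at x) u
          = g x (nabla \<Gamma> x u Y) (Z x) + g x (Y x) (nabla \<Gamma> x u Z))"

definition levi_civita :: "('e \<Rightarrow> 'e \<Rightarrow> 'e \<Rightarrow> real) \<Rightarrow> 'e::euclidean_space \<Rightarrow> 'e \<Rightarrow> 'e \<Rightarrow> 'e" where
  "levi_civita g x =
     (THE \<Gamma>. bilinear \<Gamma> \<and> torsion_free_at x \<Gamma> \<and> metric_compatible_at g x \<Gamma>)"

text \<open>
  \<open>(\<nabla>\<^sub>u \<phi>) v = \<nabla>\<^sub>u (\<phi> V) - \<phi> (\<nabla>\<^sub>u V)\<close> for any extension \<open>V\<close> of \<open>v\<close> to a vector field; the value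
  does not depend on \<open>V\<close>, and the extension with constant components in the chart is used.
\<close>

definition nabla_endo ::
  "('e \<Rightarrow> 'e \<Rightarrow> 'e \<Rightarrow> real) \<Rightarrow> ('e \<Rightarrow> 'e \<Rightarrow> 'e) \<Rightarrow> 'e \<Rightarrow> 'e \<Rightarrow> 'e \<Rightarrow> 'e::euclidean_space" where
  "nabla_endo g \<phi> x u v =
     nabla (levi_civita g x) x u (\<lambda>y. \<phi> y v) - \<phi> x (nabla (levi_civita g x) x u (\<lambda>y. v))"

section \<open>Almost paracomplex Riemannian manifolds\<close>

definition almost_paracomplex_riemannian ::
  "('i, 'a::{t2_space,second_countable_topology}, 'e::euclidean_space) manifold \<Rightarrow>
   ('i, 'e) endo_field \<Rightarrow> ('i, 'e) bilin_field \<Rightarrow> bool" where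
  "almost_paracomplex_riemannian N P h \<longleftrightarrow>
     smooth_manifold N \<and> even DIM('e) \<and> endomorphism_field N P \<and> riemannian_metric N h \<and>
     (\<forall>i\<in>Idx N. \<forall>x\<in>Img N i.
        (\<forall>v. P i x (P i x v) = v) \<and> P i x \<noteq> id \<and> trace_endo (P i x) = 0 \<and>
        (\<forall>v w. h i x (P i x v) (P i x w) = h i x v w))"

definition W0_manifold ::
  "('i, 'a::{t2_space,second_countable_topology}, 'e::euclidean_space) manifold \<Rightarrow>
   ('i, 'e) endo_field \<Rightarrow> ('i, 'e) bilin_field \<Rightarrow> bool" where
  "W0_manifold N P h \<longleftrightarrow> almost_paracomplex_riemannian N P h \<and>
     (\<forall>i\<in>Idx N. \<forall>x\<in>Img N i. \<forall>u v. nabla_endo (h i) (P i) x u v = 0)"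

section \<open>Almost paracontact almost paracomplex Riemannian manifolds\<close>

definition apapR ::
  "('i, 'a::{t2_space,second_countable_topology}, 'e::euclidean_space) manifold \<Rightarrow>
   ('i, 'e) endo_field \<Rightarrow> ('i, 'e) vec_field \<Rightarrow> ('i, 'e) one_form \<Rightarrow> ('i, 'e) bilin_field \<Rightarrow> bool"
  where
  "apapR M \<phi> \<xi> \<eta> g \<longleftrightarrow>
     smooth_manifold M \<and> odd DIM('e) \<and> endomorphism_field M \<phi> \<and> vector_field M \<xi> \<and>
     one_form_field M \<eta> \<and> riemannian_metric M g \<and>
     (\<forall>i\<in>Idx M. \<forall>x\<in>Img M i.
        (\<forall>v. \<phi> i x (\<phi> i x v) = v - \<eta> i x v *\<^sub>R \<xi> i x) \<and>
        \<eta> i x (\<xi> i x) = 1 \<and> (\<forall>v. \<eta> i x (\<phi> i x v) = 0) \<and> \<phi> i x (\<xi> i x) = 0 \<and>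
        trace_endo (\<phi> i x) = 0 \<and>
        (\<forall>v w. g i x (\<phi> i x v) (\<phi> i x w) = g i x v w - \<eta> i x v * \<eta> i x w))"

definition fundamental_tensor ::
  "('i, 'e::euclidean_space) endo_field \<Rightarrow> ('i, 'e) bilin_field \<Rightarrow>
   'i \<Rightarrow> 'e \<Rightarrow> 'e \<Rightarrow> 'e \<Rightarrow> 'e \<Rightarrow> real" where
  "fundamental_tensor \<phi> g i x u v w = g i x (nabla_endo (g i) (\<phi> i) x u v) w"

definition phi_basis ::
  "('e \<Rightarrow> 'e) \<Rightarrow> 'e \<Rightarrow> ('e \<Rightarrow> 'e \<Rightarrow> real) \<Rightarrow> (nat \<Rightarrow> 'e::euclidean_space) \<Rightarrow> bool" where
  "phi_basis \<phi> \<xi> g e \<longleftrightarrow>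
     (\<forall>j<3. \<forall>k<3. g (e j) (e k) = (if j = k then 1 else 0)) \<and> span (e ` {..<3}) = UNIV \<and>
     e 0 = \<xi> \<and> \<phi> (e 0) = 0 \<and> \<phi> (e 1) = e 2 \<and> \<phi> (e 2) = e 1"

definition theta ::
  "('e \<Rightarrow> 'e \<Rightarrow> 'e \<Rightarrow> real) \<Rightarrow> (nat \<Rightarrow> 'e) \<Rightarrow> 'e \<Rightarrow> real" where
  "theta F e z = (\<Sum>i=1..2. F (e i) (e i) z)"

definition theta_star ::
  "('e \<Rightarrow> 'e \<Rightarrow> 'e \<Rightarrow> real) \<Rightarrow> ('e \<Rightarrow> 'e) \<Rightarrow> (nat \<Rightarrow> 'e) \<Rightarrow> 'e \<Rightarrow> real" where
  "theta_star F \<phi> e z = (\<Sum>i=1..2. F (e i) (\<phi> (e i)) z)"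

text \<open>
  In the tensors \<open>F\<^sup>1\<close>, \<open>F\<^sup>5\<close> below and in \<open>in_class\<close>, the functions \<open>a\<close>, \<open>b\<close>, \<open>c\<close> are the
  components of three tangent vectors with respect to the \<open>\<phi>\<close>-basis \<open>e\<close>.
\<close>

definition F1_tensor ::
  "('e \<Rightarrow> 'e \<Rightarrow> 'e \<Rightarrow> real) \<Rightarrow> ('e \<Rightarrow> 'e) \<Rightarrow> (nat \<Rightarrow> 'e) \<Rightarrow>
   (nat \<Rightarrow> real) \<Rightarrow> (nat \<Rightarrow> real) \<Rightarrow> (nat \<Rightarrow> real) \<Rightarrow> real" where
  "F1_tensor F \<phi> e a b c =
     (a 1 * theta F e (e 1) - a 2 * theta F e (e 2)) * (b 1 * c 1 - b 2 * c 2)"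

definition F5_tensor ::
  "('e \<Rightarrow> 'e \<Rightarrow> 'e \<Rightarrow> real) \<Rightarrow> ('e \<Rightarrow> 'e) \<Rightarrow> (nat \<Rightarrow> 'e) \<Rightarrow>
   (nat \<Rightarrow> real) \<Rightarrow> (nat \<Rightarrow> real) \<Rightarrow> (nat \<Rightarrow> real) \<Rightarrow> real" where
  "F5_tensor F \<phi> e a b c = 1/2 * theta_star F \<phi> e (e 0) *
     (a 1 * (b 0 * c 2 + b 2 * c 0) + a 2 * (b 0 * c 1 + b 1 * c 0))"

definition in_class ::
  "(('e \<Rightarrow> 'e \<Rightarrow> 'e \<Rightarrow> real) \<Rightarrow> ('e \<Rightarrow> 'e) \<Rightarrow> (nat \<Rightarrow> 'e) \<Rightarrow>
     (nat \<Rightarrow> real) \<Rightarrow> (nat \<Rightarrow> real) \<Rightarrow> (nat \<Rightarrow> real) \<Rightarrow> real) \<Rightarrow>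
   ('i, 'a::{t2_space,second_countable_topology}, 'e::euclidean_space) manifold \<Rightarrow>
   ('i, 'e) endo_field \<Rightarrow> ('i, 'e) vec_field \<Rightarrow> ('i, 'e) one_form \<Rightarrow> ('i, 'e) bilin_field \<Rightarrow> bool"
  where
  "in_class T M \<phi> \<xi> \<eta> g \<longleftrightarrow>
     apapR M \<phi> \<xi> \<eta> g \<and> DIM('e) = 3 \<and>
     (\<forall>i\<in>Idx M. \<forall>x\<in>Img M i. \<forall>e. phi_basis (\<phi> i x) (\<xi> i x) (g i x) e \<longrightarrow>
        (\<forall>a b c. fundamental_tensor \<phi> g i x
             (\<Sum>k<3. a k *\<^sub>R e k) (\<Sum>k<3. b k *\<^sub>R e k) (\<Sum>k<3. c k *\<^sub>R e k)
           = T (fundamental_tensor \<phi> g i x) (\<phi> i x) e a b c))"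

definition class_F1 where
  "class_F1 M \<phi> \<xi> \<eta> g \<longleftrightarrow> in_class F1_tensor M \<phi> \<xi> \<eta> g"

definition class_F5 where
  "class_F5 M \<phi> \<xi> \<eta> g \<longleftrightarrow> in_class F5_tensor M \<phi> \<xi> \<eta> g"

definition class_F1_F5 where
  "class_F1_F5 M \<phi> \<xi> \<eta> g \<longleftrightarrow>
     in_class (\<lambda>F f e a b c. F1_tensor F f e a b c + F5_tensor F f e a b c) M \<phi> \<xi> \<eta> g"

section \<open>The cone\<close>

text \<open>
  The underlying space is \<open>{0<..} \<times> carrier N\<close>, and in the product charts the tangent vector
  \<open>(x', a d/dt)\<close> is the pair \<open>(a, v)\<close>, where \<open>v\<close> represents \<open>x'\<close>.
\<close>

definition cone_manifold :: "('i, 'a, 'e) manifold \<Rightarrow> ('i, real \<times> 'a, real \<times> 'e) manifold" where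
  "cone_manifold N = \<lparr> Idx = Idx N, Dom = (\<lambda>i. {0<..} \<times> Dom N i), Crd = (\<lambda>i (t, p). (t, Crd N i p)) \<rparr>"

definition cone_metric :: "('i, 'e) bilin_field \<Rightarrow> ('i, real \<times> 'e) bilin_field" where
  "cone_metric h = (\<lambda>i (t, x) (a, v) (b, w). t\<^sup>2 * h i x v w + a * b)"

definition cone_phi :: "('i, 'e) endo_field \<Rightarrow> ('i, real \<times> 'e) endo_field" where
  "cone_phi P = (\<lambda>i (t, x) (a, v). (0, P i x v))"

definition cone_xi :: "('i, real \<times> 'e::euclidean_space) vec_field" where
  "cone_xi = (\<lambda>i (t, x). (1, 0))"

definition cone_eta :: "('i, real \<times> 'e) one_form" where
  "cone_eta = (\<lambda>i (t, x) (a, v). a)"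

end

theory Submission
  imports Defs
begin

text \<open>
  In a product chart of the cone write \<open>u = (a, u')\<close>, \<open>v = (b, v')\<close>, \<open>w = (c, w')\<close>, where \<open>a\<close>, \<open>b\<close>, \<open>c\<close>
  are the components along \<open>d/dt\<close>, and let \<open>\<nabla>'\<close> be the Levi-Civita connection of \<open>h\<close>. The connection
  of the warped metric \<open>t\<^sup>2 h + dt\<^sup>2\<close> is explicit (\<open>levi_civita_cone\<close>), and covariant
  differentiation of \<open>\<phi>\<close> with it gives the fundamental tensor (\<open>fundamental_tensor_cone\<close>)

  \<open>F(u, v, w) = t\<^sup>2 h((\<nabla>'\<^sub>u\<^sub>' P) v', w') - t (b h(P u', w') + c h(u', P v'))\<close>.

  Both parts are rigid when \<open>dim N = 2\<close>. In the first one, differentiating \<open>h(Pv, w) = h(v, Pw)\<close> and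
  \<open>h(Pv, Pw) = h(v, w)\<close> shows that \<open>h((\<nabla>'\<^sub>u P) v, w)\<close> is symmetric in \<open>v, w\<close> and that \<open>\<nabla>'\<^sub>u P\<close>
  anticommutes with \<open>P\<close>. On a basis \<open>p, q\<close> exchanged by \<open>P\<close> this form is therefore a multiple of
  \<open>v\<^sup>1 w\<^sup>1 - v\<^sup>2 w\<^sup>2\<close> (\<open>nabla_form_expand\<close>), which is the shape of \<open>F\<^sup>1\<close>. The second part has the shape of
  \<open>F\<^sup>5\<close> with \<open>\<theta>\<^sup>*\<^sub>0 = - 2/t\<close> (\<open>theta_cone\<close>). So the cone is always in \<open>F\<^sub>1 \<oplus> F\<^sub>5\<close>; its \<open>F\<^sup>1\<close>-part vanishes
  exactly when \<open>\<nabla>' P = 0\<close>, and its \<open>F\<^sup>5\<close>-part never vanishes. The last two conclusions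
  need a \<open>\<phi>\<close>-basis at every point, which eigenvectors of \<open>P\<close> provide (\<open>phi_basis_cone_exists\<close>).
\<close>

section \<open>Calculus of smooth maps\<close>

lemma Ck_on_cong:
  assumes "Ck_on k f S" and S: "open S" and "\<And>x. x \<in> S \<Longrightarrow> f x = g x"
  shows "Ck_on k g S"
  using assms(1,3)
proof (induction k arbitrary: f g)
  case 0
  then show ?case using continuous_on_cong[of S S f g] by simp
next
  case (Suc k)
  have der: "(g has_derivative frechet_derivative f (at x)) (at x)" if "x \<in> S" for x
    by (rule has_derivative_transform_within_open[OF _ S that, where f = f])
       (use Suc.prems that in \<open>auto simp: frechet_derivative_works\<close>)
  show ?case unfolding Ck_on.simps
  proof (intro conjI ballI allI)
    show "g differentiable (at x)" if "x \<in> S" for x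
      using der[OF that] by (auto simp: differentiable_def)
    have "Ck_on k (\<lambda>x. frechet_derivative f (at x) v) S" for v
      using Suc.prems by simp
    then show "Ck_on k (\<lambda>x. frechet_derivative g (at x) v) S" for v
      by (rule Suc.IH) (simp add: frechet_derivative_at[OF der, symmetric])
  qed
qed

lemma smooth_on_cong:
  "smooth_on S f \<Longrightarrow> (\<And>x. x \<in> S \<Longrightarrow> f x = g x) \<Longrightarrow> smooth_on S g"
  unfolding smooth_on_def using Ck_on_cong by blast

text \<open>
  All the closure properties below are inductions on the order of differentiability; this rule
  lets each of them exhibit the derivative instead of computing with the one chosen by
  \<^const>\<open>frechet_derivative\<close>.
\<close>

lemma Ck_on_SucI:
  assumes S: "open S" and der: "\<And>x. x \<in> S \<Longrightarrow> (f has_derivative f' x) (at x)"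
    and Ck: "\<And>v. Ck_on k (\<lambda>x. f' x v) S"
  shows "Ck_on (Suc k) f S"
  unfolding Ck_on.simps
proof (intro conjI ballI allI)
  show "f differentiable (at x)" if "x \<in> S" for x
    using der[OF that] by (auto simp: differentiable_def)
  show "Ck_on k (\<lambda>x. frechet_derivative f (at x) v) S" for v
    by (rule Ck_on_cong[OF Ck[of v] S]) (simp add: frechet_derivative_at[OF der, symmetric])
qed

lemma Ck_on_SucD:
  assumes "Ck_on (Suc k) f S"
  shows "x \<in> S \<Longrightarrow> (f has_derivative frechet_derivative f (at x)) (at x)"
    and "Ck_on k (\<lambda>x. frechet_derivative f (at x) v) S"
  using assms by (auto simp: frechet_derivative_works)

lemma Ck_on_lower: "Ck_on (Suc k) f S \<Longrightarrow> Ck_on k f S"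
proof (induction k arbitrary: f)
  case 0
  then show ?case
    by (auto intro!: continuous_at_imp_continuous_on differentiable_imp_continuous_within)
next
  case (Suc k)
  then show ?case by (metis Ck_on.simps(2))
qed

lemma Ck_on_const: "open S \<Longrightarrow> Ck_on k (\<lambda>x. c) S"
proof (induction k arbitrary: c)
  case (Suc k)
  then show ?case by (intro Ck_on_SucI[where f' = "\<lambda>x v. 0"]) auto
qed simp

lemma Ck_on_bounded_linear: "bounded_linear f \<Longrightarrow> open S \<Longrightarrow> Ck_on k f S"
proof (cases k)
  case (Suc n)
  assume "bounded_linear f" "open S"
  then show ?thesis unfolding Suc
    by (intro Ck_on_SucI[where f' = "\<lambda>x v. f v"] Ck_on_const bounded_linear_imp_has_derivative)
qed (simp add: linear_continuous_on)

lemma Ck_on_add: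
  "open S \<Longrightarrow> Ck_on k f S \<Longrightarrow> Ck_on k g S \<Longrightarrow> Ck_on k (\<lambda>x. f x + g x) S"
proof (induction k arbitrary: f g)
  case (Suc k)
  note f = Ck_on_SucD[OF Suc.prems(2)] and g = Ck_on_SucD[OF Suc.prems(3)]
  show ?case
    by (rule Ck_on_SucI[OF \<open>open S\<close> has_derivative_add[OF f(1) g(1)]])
       (auto intro: Suc.IH f g \<open>open S\<close>)
qed (simp add: continuous_on_add)

lemma Ck_on_bilinear:
  assumes "bounded_bilinear B" and S: "open S"
  shows "Ck_on k f S \<Longrightarrow> Ck_on k g S \<Longrightarrow> Ck_on k (\<lambda>x. B (f x) (g x)) S"
proof (induction k arbitrary: f g)
  case 0
  then show ?case using assms by (simp add: bounded_bilinear.continuous_on)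
next
  case (Suc k)
  note f = Ck_on_SucD[OF Suc.prems(1)] and g = Ck_on_SucD[OF Suc.prems(2)]
  show ?case
    by (rule Ck_on_SucI[OF S bounded_bilinear.FDERIV[OF assms(1) f(1) g(1)]], assumption+)
       (intro Ck_on_add[OF S] Suc.IH f(2) g(2) Ck_on_lower[OF Suc.prems(1)] Ck_on_lower[OF Suc.prems(2)])
qed

lemma Ck_on_compose_linear:
  assumes L: "bounded_linear L" and S: "open S"
  shows "Ck_on k f S \<Longrightarrow> Ck_on k (\<lambda>x. L (f x)) S"
proof (induction k arbitrary: f)
  case 0
  then show ?case by (simp add: bounded_linear.continuous_on[OF L])
next
  case (Suc k)
  note f = Ck_on_SucD[OF Suc.prems]
  show ?case
    by (rule Ck_on_SucI[OF S bounded_linear.has_derivative[OF L f(1)]])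
       (auto intro: Suc.IH f)
qed

lemma Ck_on_linear_compose:
  assumes L: "bounded_linear L" and S: "open S" "L ` S \<subseteq> T"
  shows "Ck_on k f T \<Longrightarrow> Ck_on k (\<lambda>x. f (L x)) S"
proof (induction k arbitrary: f)
  case 0
  then show ?case
    using continuous_on_compose2[OF _ linear_continuous_on[OF L] S(2)] by simp
next
  case (Suc k)
  note f = Ck_on_SucD[OF Suc.prems]
  have "((\<lambda>x. f (L x)) has_derivative (\<lambda>v. frechet_derivative f (at (L x)) (L v))) (at x)"
    if "x \<in> S" for x
    using diff_chain_at[OF bounded_linear_imp_has_derivative[OF L] f(1)] S that
    by (auto simp: o_def)
  then show ?case
    by (rule Ck_on_SucI[OF S(1)]) (auto intro: Suc.IH f)
qed

lemma smooth_on_const: "open S \<Longrightarrow> smooth_on S (\<lambda>x. c)"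
  by (simp add: smooth_on_def Ck_on_const)

lemma smooth_on_bounded_linear: "bounded_linear f \<Longrightarrow> open S \<Longrightarrow> smooth_on S f"
  by (simp add: smooth_on_def Ck_on_bounded_linear)

lemma smooth_on_add: "smooth_on S f \<Longrightarrow> smooth_on S g \<Longrightarrow> smooth_on S (\<lambda>x. f x + g x)"
  by (simp add: smooth_on_def Ck_on_add)

lemma smooth_on_mult:
  fixes f g :: "'e::euclidean_space \<Rightarrow> real"
  shows "smooth_on S f \<Longrightarrow> smooth_on S g \<Longrightarrow> smooth_on S (\<lambda>x. f x * g x)"
  by (simp add: smooth_on_def Ck_on_bilinear[OF bounded_bilinear_mult])

lemma smooth_on_compose_linear:
  "smooth_on S f \<Longrightarrow> bounded_linear L \<Longrightarrow> smooth_on S (\<lambda>x. L (f x))"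
  by (simp add: smooth_on_def Ck_on_compose_linear)

lemma smooth_on_snd:
  fixes f :: "'e::euclidean_space \<Rightarrow> 'f::euclidean_space" and T :: "real set"
  assumes "smooth_on S f" "open T"
  shows "smooth_on (T \<times> S) (\<lambda>z. f (snd z))"
  using assms unfolding smooth_on_def
  by (auto intro!: Ck_on_linear_compose[OF bounded_linear_snd, where T = S] open_Times)

lemma smooth_on_imp_differentiable: "smooth_on S f \<Longrightarrow> x \<in> S \<Longrightarrow> f differentiable (at x)"
  unfolding smooth_on_def using Ck_on.simps(2) by blast


section \<open>The Levi-Civita connection in a chart\<close>

text \<open>
  The product rule for three varying factors: in a basis the pairing is a finite sum of products of
  coefficient functions.
\<close>

lemma has_derivative_pairing:
  fixes g :: "'e::euclidean_space \<Rightarrow> 'e \<Rightarrow> 'e \<Rightarrow> real"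
  assumes S: "open S" "x \<in> S" and bil: "\<And>y. y \<in> S \<Longrightarrow> bilinear (g y)"
    and der: "\<And>v w. ((\<lambda>y. g y v w) has_derivative (\<lambda>u. G u v w)) (at x)"
    and Y: "(Y has_derivative Y') (at x)" and Z: "(Z has_derivative Z') (at x)"
  shows "((\<lambda>y. g y (Y y) (Z y)) has_derivative
    (\<lambda>u. G u (Y x) (Z x) + g x (Y' u) (Z x) + g x (Y x) (Z' u))) (at x)"
proof -
  have exp: "g y v w = (\<Sum>b\<in>Basis. \<Sum>c\<in>Basis. (v \<bullet> b) * (w \<bullet> c) * g y b c)" if "y \<in> S" for y v w
  proof -
    have "g y v w = g y (\<Sum>b\<in>Basis. (v \<bullet> b) *\<^sub>R b) (\<Sum>c\<in>Basis. (w \<bullet> c) *\<^sub>R c)"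
      by (simp add: euclidean_representation)
    also have "\<dots> = (\<Sum>(b,c)\<in>Basis \<times> Basis. (v \<bullet> b) * (w \<bullet> c) * g y b c)"
      unfolding bilinear_sum[OF bil[OF that]]
      by (simp add: bilinear_lmul[OF bil[OF that]] bilinear_rmul[OF bil[OF that]] mult_ac)
    finally show ?thesis by (simp add: sum.cartesian_product)
  qed
  have expG: "G u v w = (\<Sum>b\<in>Basis. \<Sum>c\<in>Basis. (v \<bullet> b) * (w \<bullet> c) * G u b c)" for u v w
  proof -
    have "((\<lambda>y. \<Sum>b\<in>Basis. \<Sum>c\<in>Basis. (v \<bullet> b) * (w \<bullet> c) * g y b c) has_derivative
      (\<lambda>u. \<Sum>b\<in>Basis. \<Sum>c\<in>Basis. (v \<bullet> b) * (w \<bullet> c) * G u b c)) (at x)"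
      by (intro has_derivative_sum has_derivative_mult_right der)
    then have "((\<lambda>y. g y v w) has_derivative
      (\<lambda>u. \<Sum>b\<in>Basis. \<Sum>c\<in>Basis. (v \<bullet> b) * (w \<bullet> c) * G u b c)) (at x)"
      by (rule has_derivative_transform_within_open[OF _ S]) (rule exp[symmetric])
    from has_derivative_unique[OF this der] show ?thesis by metis
  qed
  have "((\<lambda>y. \<Sum>b\<in>Basis. \<Sum>c\<in>Basis. ((Y y \<bullet> b) * (Z y \<bullet> c)) * g y b c) has_derivative
    (\<lambda>u. \<Sum>b\<in>Basis. \<Sum>c\<in>Basis. ((Y x \<bullet> b) * (Z x \<bullet> c)) * G u b c +
       ((Y x \<bullet> b) * (Z' u \<bullet> c) + (Y' u \<bullet> b) * (Z x \<bullet> c)) * g x b c)) (at x)"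
    by (intro has_derivative_sum has_derivative_mult der has_derivative_inner_left Y Z)
  then have "((\<lambda>y. g y (Y y) (Z y)) has_derivative
    (\<lambda>u. \<Sum>b\<in>Basis. \<Sum>c\<in>Basis. ((Y x \<bullet> b) * (Z x \<bullet> c)) * G u b c +
       ((Y x \<bullet> b) * (Z' u \<bullet> c) + (Y' u \<bullet> b) * (Z x \<bullet> c)) * g x b c)) (at x)"
    by (rule has_derivative_transform_within_open[OF _ S]) (simp add: exp)
  also have "(\<lambda>u. \<Sum>b\<in>Basis. \<Sum>c\<in>Basis. ((Y x \<bullet> b) * (Z x \<bullet> c)) * G u b c +
       ((Y x \<bullet> b) * (Z' u \<bullet> c) + (Y' u \<bullet> b) * (Z x \<bullet> c)) * g x b c) =
     (\<lambda>u. G u (Y x) (Z x) + g x (Y' u) (Z x) + g x (Y x) (Z' u))"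
    unfolding expG[of _ "Y x" "Z x"] exp[OF S(2), of "Y' _" "Z x"] exp[OF S(2), of "Y x" "Z' _"]
    by (simp add: sum.distrib algebra_simps)
  finally show ?thesis .
qed

text \<open>
  Positive definiteness makes \<open>w \<mapsto> B w\<close> injective, hence onto the dual space by dimension.
\<close>

lemma nondegenerate_representation:
  fixes B :: "'e::euclidean_space \<Rightarrow> 'e \<Rightarrow> real"
  assumes B: "bilinear B" and pos: "\<And>v. v \<noteq> 0 \<Longrightarrow> B v v > 0" and l: "linear l"
  shows "\<exists>w. \<forall>z. B w z = l z"
proof -
  let ?f = "\<lambda>w. \<Sum>b\<in>Basis. B w b *\<^sub>R b"
  have lin: "linear ?f"
    by (rule linearI)
       (simp_all add: bilinear_ladd[OF B] bilinear_lmul[OF B] algebra_simps sum.distrib scaleR_sum_right)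
  have eq: "\<forall>z. B w z = m z" if "linear m" "\<And>b. b \<in> Basis \<Longrightarrow> B w b = m b" for w m
    using linear_eq_stdbasis[of "B w" m] that B by (auto simp: bilinear_def)
  have "inj ?f"
  proof (rule linear_injective_0[OF lin, THEN iffD2], intro allI impI)
    fix w assume "?f w = 0"
    then have "B w b = 0" if "b \<in> Basis" for b
      using inner_sum_left_Basis[OF that, of "B w"] by simp
    then have "B w w = 0" using eq[of "\<lambda>_. 0" w] by (simp add: linear_zero)
    then show "w = 0" using pos[of w] by fastforce
  qed
  then obtain w where "?f w = (\<Sum>b\<in>Basis. l b *\<^sub>R b)"
    using surjD[OF linear_injective_imp_surjective[OF lin], of "\<Sum>b\<in>Basis. l b *\<^sub>R b"] by auto
  then have w: "?f w \<bullet> b = (\<Sum>b\<in>Basis. l b *\<^sub>R b) \<bullet> b" for b by simp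
  have "B w b = l b" if "b \<in> Basis" for b
    using w[of b] inner_sum_left_Basis[OF that, of "B w"] inner_sum_left_Basis[OF that, of l] by simp
  then show ?thesis using eq[OF l] by blast
qed

text \<open>
  Torsion-freeness and metric compatibility, tested on the coordinate vector fields only. This
  pointwise condition on Christoffel symbols suffices to identify the Levi-Civita connection, since
  the terms containing derivatives of the vector fields cancel in both axioms.
\<close>

definition christoffel_at ::
  "('e \<Rightarrow> 'e \<Rightarrow> 'e \<Rightarrow> real) \<Rightarrow> 'e::euclidean_space \<Rightarrow> ('e \<Rightarrow> 'e \<Rightarrow> 'e) \<Rightarrow> bool" where
  "christoffel_at g x \<Gamma> \<longleftrightarrow> bilinear \<Gamma> \<and> (\<forall>u v. \<Gamma> u v = \<Gamma> v u) \<and>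
     (\<forall>u v w. frechet_derivative (\<lambda>y. g y v w) (at x) u = g x (\<Gamma> u v) w + g x v (\<Gamma> u w))"

locale metric_chart =
  fixes S :: "'e::euclidean_space set" and g :: "'e \<Rightarrow> 'e \<Rightarrow> 'e \<Rightarrow> real"
  assumes open_chart: "open S"
    and metric_bilinear: "x \<in> S \<Longrightarrow> bilinear (g x)"
    and metric_sym: "x \<in> S \<Longrightarrow> g x v w = g x w v"
    and metric_pos: "x \<in> S \<Longrightarrow> v \<noteq> 0 \<Longrightarrow> g x v v > 0"
    and metric_differentiable: "x \<in> S \<Longrightarrow> (\<lambda>y. g y v w) differentiable (at x)"
begin

lemma metric_has_derivative:
  "x \<in> S \<Longrightarrow>
    ((\<lambda>y. g y v w) has_derivative frechet_derivative (\<lambda>y. g y v w) (at x)) (at x)"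
  using metric_differentiable frechet_derivative_works by blast

lemma metric_nondegenerate:
  assumes x: "x \<in> S" and "\<And>z. g x v z = g x w z"
  shows "v = w"
proof -
  have "g x (v - w) (v - w) = 0"
    using assms(2) by (simp add: bilinear_lsub[OF metric_bilinear[OF x]])
  then show ?thesis using metric_pos[OF x, of "v - w"] by fastforce
qed

lemma christoffel_at_iff_levi_civita:
  assumes x: "x \<in> S"
  shows "bilinear \<Gamma> \<and> torsion_free_at x \<Gamma> \<and> metric_compatible_at g x \<Gamma> \<longleftrightarrow> christoffel_at g x \<Gamma>"
proof
  assume *: "bilinear \<Gamma> \<and> torsion_free_at x \<Gamma> \<and> metric_compatible_at g x \<Gamma>"
  have "nabla \<Gamma> x u (\<lambda>_. v) - nabla \<Gamma> x v (\<lambda>_. u) = lie_bracket (\<lambda>_. u) (\<lambda>_. v) x" for u v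
    using * unfolding torsion_free_at_def by (metis differentiable_const)
  then have "\<Gamma> u v - \<Gamma> v u = 0" for u v
    by (simp add: nabla_def lie_bracket_def)
  moreover have "frechet_derivative (\<lambda>y. g y v w) (at x) u = g x (\<Gamma> u v) w + g x v (\<Gamma> u w)" for u v w
    using * unfolding metric_compatible_at_def
    by (auto simp: nabla_def dest!: spec[where x = u] spec[where x = "\<lambda>_. v"] spec[where x = "\<lambda>_. w"])
  ultimately show "christoffel_at g x \<Gamma>" using * by (simp add: christoffel_at_def)
next
  assume *: "christoffel_at g x \<Gamma>"
  have "frechet_derivative (\<lambda>y. g y (Y y) (Z y)) (at x) u
      = g x (nabla \<Gamma> x u Y) (Z x) + g x (Y x) (nabla \<Gamma> x u Z)"
    if "Y differentiable (at x)" "Z differentiable (at x)" for u Y Z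
  proof -
    note pair = has_derivative_pairing[OF open_chart x metric_bilinear metric_has_derivative[OF x]
        that[unfolded frechet_derivative_works]]
    show ?thesis using *
      by (simp add: frechet_derivative_at[OF pair, symmetric] christoffel_at_def nabla_def
          bilinear_ladd[OF metric_bilinear[OF x]] bilinear_radd[OF metric_bilinear[OF x]])
  qed
  then have "metric_compatible_at g x \<Gamma>" by (auto simp: metric_compatible_at_def)
  moreover have "torsion_free_at x \<Gamma>"
    using * by (auto simp: torsion_free_at_def nabla_def lie_bracket_def christoffel_at_def)
  ultimately show "bilinear \<Gamma> \<and> torsion_free_at x \<Gamma> \<and> metric_compatible_at g x \<Gamma>"
    using * by (simp add: christoffel_at_def)
qed

text \<open>
  The difference of two candidates, paired with the metric, is symmetric in its first two and skew
  in its last two arguments; such a trilinear form is zero.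
\<close>

lemma christoffel_at_unique:
  assumes x: "x \<in> S" and "christoffel_at g x \<Gamma>" "christoffel_at g x \<Gamma>'"
  shows "\<Gamma> = \<Gamma>'"
proof -
  define T where "T u v w = g x (\<Gamma> u v) w - g x (\<Gamma>' u v) w" for u v w
  have sym: "T u v w = T v u w" for u v w
    using assms(2,3) unfolding T_def christoffel_at_def by metis
  have skew: "T u v w = - T u w v" for u v w
  proof -
    have "g x (\<Gamma> u v) w + g x v (\<Gamma> u w) = g x (\<Gamma>' u v) w + g x v (\<Gamma>' u w)"
      using assms(2,3) unfolding christoffel_at_def by metis
    then show ?thesis unfolding T_def using metric_sym[OF x, of v] by simp
  qed
  have "T u v w = 0" for u v w
    using skew[of u v w] sym[of u w v] skew[of w u v] sym[of w v u] skew[of v w u] sym[of v u w]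
    by linarith
  then have "\<Gamma> u v = \<Gamma>' u v" for u v
    by (intro metric_nondegenerate[OF x]) (simp add: T_def)
  then show ?thesis by blast
qed

text \<open>
  Koszul's formula prescribes \<open>g(\<Gamma>(u, v), z)\<close> for all \<open>z\<close>, and the metric represents this linear
  form by a vector.
\<close>

lemma christoffel_at_exists:
  assumes x: "x \<in> S"
  shows "\<exists>\<Gamma>. christoffel_at g x \<Gamma>"
proof -
  define D where "D u v w = frechet_derivative (\<lambda>y. g y v w) (at x) u" for u v w
  have der: "((\<lambda>y. g y v w) has_derivative (\<lambda>u. D u v w)) (at x)" for v w
    using metric_has_derivative[OF x] by (simp add: D_def)
  have symD: "D u v w = D u w v" for u v w
  proof -
    have "((\<lambda>y. g y w v) has_derivative (\<lambda>u. D u v w)) (at x)"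
      by (rule has_derivative_transform_within_open[OF der[of v w] open_chart x]) (rule metric_sym)
    from has_derivative_unique[OF this der] show ?thesis by metis
  qed
  have D1: "linear (\<lambda>u. D u v w)" for v w
    using has_derivative_linear[OF der] .
  have D2: "linear (\<lambda>v. D u v w)" for u w
  proof (rule linearI)
    show "D u (v + v') w = D u v w + D u v' w" for v v'
    proof -
      have "((\<lambda>y. g y (v + v') w) has_derivative (\<lambda>u. D u v w + D u v' w)) (at x)"
        by (rule has_derivative_transform_within_open
            [OF has_derivative_add[OF der[of v w] der[of v' w]] open_chart x])
           (simp add: bilinear_ladd[OF metric_bilinear])
      from has_derivative_unique[OF this der] show ?thesis by metis
    qed
    show "D u (r *\<^sub>R v) w = r *\<^sub>R D u v w" for r v
    proof -
      have "((\<lambda>y. g y (r *\<^sub>R v) w) has_derivative (\<lambda>u. r * D u v w)) (at x)"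
        by (rule has_derivative_transform_within_open
            [OF has_derivative_mult_right[OF der[of v w]] open_chart x])
           (simp add: bilinear_lmul[OF metric_bilinear])
      from has_derivative_unique[OF this der] show ?thesis by (metis real_scaleR_def)
    qed
  qed
  note Dlin = linear_add[OF D1] linear_add[OF D2] linear_scale[OF D1] linear_scale[OF D2]
  have Dlin3: "D u v (w + w') = D u v w + D u v w'" "D u v (r *\<^sub>R w) = r *\<^sub>R D u v w" for u v w w' r
    using Dlin symD by metis+
  \<comment> \<open>Koszul's formula on coordinate fields, whose brackets vanish.\<close>
  define K where "K u v z = (D u v z + D v u z - D z u v) / 2" for u v z
  have "linear (K u v)" for u v
    by (rule linearI) (simp_all add: K_def Dlin Dlin3 field_simps)
  then have "\<exists>w. \<forall>z. g x w z = K u v z" for u v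
    using nondegenerate_representation[OF metric_bilinear[OF x] metric_pos[OF x]] by blast
  then obtain \<Gamma> where \<Gamma>: "g x (\<Gamma> u v) z = K u v z" for u v z by metis
  note g = bilinear_ladd[OF metric_bilinear[OF x]] bilinear_lmul[OF metric_bilinear[OF x]]
  have sym: "\<Gamma> u v = \<Gamma> v u" for u v
    by (rule metric_nondegenerate[OF x]) (simp add: \<Gamma> K_def symD[of _ u v])
  have lin: "linear (\<Gamma> u)" for u
    by (rule linearI; rule metric_nondegenerate[OF x])
       (simp_all add: \<Gamma> g, simp_all add: K_def Dlin Dlin3 field_simps)
  moreover have "(\<lambda>u. \<Gamma> u v) = \<Gamma> v" for v using sym by blast
  ultimately have "bilinear \<Gamma>" by (simp add: bilinear_def)
  moreover have "D u v w = g x (\<Gamma> u v) w + g x v (\<Gamma> u w)" for u v w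
    unfolding metric_sym[OF x, of v] \<Gamma> K_def
    using symD[of u v w] symD[of v u w] symD[of w u v] by (simp add: field_simps)
  ultimately show ?thesis using sym unfolding christoffel_at_def D_def by blast
qed

lemma levi_civita_eqI: "x \<in> S \<Longrightarrow> christoffel_at g x \<Gamma> \<Longrightarrow> levi_civita g x = \<Gamma>"
  unfolding levi_civita_def
  by (rule the_equality) (auto simp: christoffel_at_iff_levi_civita intro: christoffel_at_unique)

lemma levi_civita:
  assumes "x \<in> S"
  shows "christoffel_at g x (levi_civita g x)" "metric_compatible_at g x (levi_civita g x)"
  using christoffel_at_exists[OF assms] levi_civita_eqI[OF assms]
    christoffel_at_iff_levi_civita[OF assms] by metis+

end


section \<open>Paracomplex structures in a chart\<close>

locale paracomplex_chart = metric_chart S g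
  for S :: "'e::euclidean_space set" and g :: "'e \<Rightarrow> 'e \<Rightarrow> 'e \<Rightarrow> real" +
  fixes P :: "'e \<Rightarrow> 'e \<Rightarrow> 'e"
  assumes P_linear: "x \<in> S \<Longrightarrow> linear (P x)"
    and P_differentiable: "x \<in> S \<Longrightarrow> (\<lambda>y. P y v) differentiable (at x)"
    and P_P: "x \<in> S \<Longrightarrow> P x (P x v) = v"
    and P_isometry: "x \<in> S \<Longrightarrow> g x (P x v) (P x w) = g x v w"
begin

lemma P_symmetric: "x \<in> S \<Longrightarrow> g x (P x v) w = g x v (P x w)"
  by (metis P_P P_isometry)

definition nabla_form :: "'e \<Rightarrow> 'e \<Rightarrow> 'e \<Rightarrow> 'e \<Rightarrow> real" where
  "nabla_form x u v w = g x (nabla_endo g P x u v) w"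

lemma nabla_endo_eq:
  "nabla_endo g P x u v =
     nabla (levi_civita g x) x u (\<lambda>y. P y v) - P x (levi_civita g x u v)"
  by (simp add: nabla_endo_def nabla_def)

text \<open>Differentiating \<open>g (P v, w) = g (v, P w)\<close>.\<close>

lemma nabla_form_sym:
  assumes x: "x \<in> S"
  shows "nabla_form x u v w = nabla_form x u w v"
proof -
  let ?\<Gamma> = "levi_civita g x"
  let ?n = "\<lambda>v. nabla ?\<Gamma> x u (\<lambda>y. P y v)"
  have compat: "frechet_derivative (\<lambda>y. g y (P y v) w) (at x) u
      = g x (?n v) w + g x (P x v) (?\<Gamma> u w)" for v w
    using levi_civita(2)[OF x] P_differentiable[OF x, of v]
    unfolding metric_compatible_at_def
    by (auto simp: nabla_def dest!: spec[where x = u] spec[where x = "\<lambda>y. P y v"] spec[where x = "\<lambda>_. w"])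
  have "(\<lambda>y. g y (P y v) w) differentiable (at x)"
    using has_derivative_pairing[OF open_chart x metric_bilinear metric_has_derivative[OF x]
        P_differentiable[OF x, unfolded frechet_derivative_works] has_derivative_const]
    unfolding differentiable_def by blast
  then have "frechet_derivative (\<lambda>y. g y (P y v) w) (at x) = frechet_derivative (\<lambda>y. g y (P y w) v) (at x)"
    by (rule frechet_derivative_transform_within_open[OF _ open_chart x])
       (metis P_symmetric metric_sym)
  then have "g x (?n v) w + g x (P x v) (?\<Gamma> u w) = g x (?n w) v + g x (P x w) (?\<Gamma> u v)"
    using compat by metis
  moreover have "nabla_form x u v w = g x (?n v) w - g x (P x w) (?\<Gamma> u v)" for v w
    using P_symmetric[OF x, of "?\<Gamma> u v" w] metric_sym[OF x, of "?\<Gamma> u v" "P x w"]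
    by (simp add: nabla_form_def nabla_endo_eq bilinear_lsub[OF metric_bilinear[OF x]])
  ultimately show ?thesis by simp
qed

text \<open>Differentiating \<open>g (P v, P w) = g (v, w)\<close>; equivalently, \<open>\<nabla>\<^sub>u P\<close> anticommutes with \<open>P\<close>.\<close>

lemma nabla_form_P:
  assumes x: "x \<in> S"
  shows "nabla_form x u v (P x w) = - nabla_form x u (P x v) w"
proof -
  let ?\<Gamma> = "levi_civita g x"
  let ?n = "\<lambda>v. nabla ?\<Gamma> x u (\<lambda>y. P y v)"
  have "frechet_derivative (\<lambda>y. g y (P y v) (P y w)) (at x) u
      = g x (?n v) (P x w) + g x (P x v) (?n w)"
    using levi_civita(2)[OF x] P_differentiable[OF x]
    unfolding metric_compatible_at_def by blast
  moreover have "frechet_derivative (\<lambda>y. g y v w) (at x) = frechet_derivative (\<lambda>y. g y (P y v) (P y w)) (at x)"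
    by (rule frechet_derivative_transform_within_open[OF metric_differentiable[OF x] open_chart x])
       (metis P_isometry)
  ultimately have "g x (?n v) (P x w) + g x (P x v) (?n w) = g x (?\<Gamma> u v) w + g x v (?\<Gamma> u w)"
    using levi_civita(1)[OF x] unfolding christoffel_at_def by metis
  moreover have "g x (P x (?\<Gamma> u v)) (P x w) = g x (?\<Gamma> u v) w"
    "g x (P x (?\<Gamma> u w)) (P x v) = g x v (?\<Gamma> u w)"
    using P_isometry[OF x] metric_sym[OF x] by metis+
  ultimately have "nabla_form x u v (P x w) + nabla_form x u w (P x v) = 0"
    using metric_sym[OF x, of "P x v" "?n w"]
    by (simp add: nabla_form_def nabla_endo_eq bilinear_lsub[OF metric_bilinear[OF x]])
  then show ?thesis using nabla_form_sym[OF x, of u w] by simp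
qed

lemma nabla_form_linear:
  assumes x: "x \<in> S"
  shows "linear (\<lambda>u. nabla_form x u v w)" "linear (\<lambda>v. nabla_form x u v w)" "linear (nabla_form x u v)"
proof -
  note bil = metric_bilinear[OF x]
  show 3: "linear (nabla_form x u v)" for u v
    unfolding nabla_form_def using bil by (auto simp: bilinear_def)
  then show "linear (\<lambda>v. nabla_form x u v w)"
    using nabla_form_sym[OF x] by (metis (no_types, lifting) ext)
  have "linear (frechet_derivative (\<lambda>y. P y v) (at x))" "bilinear (levi_civita g x)"
    using linear_frechet_derivative[OF P_differentiable[OF x]] levi_civita(1)[OF x]
    by (auto simp: christoffel_at_def)
  note lin = linear_add[OF this(1)] linear_scale[OF this(1)]
    bilinear_ladd[OF this(2)] bilinear_lmul[OF this(2)]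
    linear_add[OF P_linear[OF x]] linear_scale[OF P_linear[OF x]]
    bilinear_ladd[OF bil] bilinear_lmul[OF bil] bilinear_lsub[OF bil]
  show "linear (\<lambda>u. nabla_form x u v w)"
    by (rule linearI)
       (simp_all add: nabla_form_def nabla_endo_eq nabla_def lin algebra_simps)
qed

text \<open>
  On the span of two vectors exchanged by \<open>P\<close>, the symmetry and the anticommutation with \<open>P\<close> leave
  a single component in the last two arguments.
\<close>

lemma nabla_form_expand:
  assumes x: "x \<in> S" and pq: "P x p = q" "P x q = p"
  shows "nabla_form x u (b1 *\<^sub>R p + b2 *\<^sub>R q) (c1 *\<^sub>R p + c2 *\<^sub>R q) =
    nabla_form x u p p * (b1 * c1 - b2 * c2)"
proof -
  note nf = nabla_form_linear[OF x]
  have qq: "nabla_form x u q q = - nabla_form x u p p"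
    using nabla_form_P[OF x, of u q p] pq by simp
  have pq0: "nabla_form x u p q = 0"
    using nabla_form_P[OF x, of u p p] pq nabla_form_sym[OF x, of u p q] by simp
  have qp0: "nabla_form x u q p = 0"
    using pq0 nabla_form_sym[OF x] by simp
  show ?thesis
    by (simp add: linear_add[OF nf(2)] linear_add[OF nf(3)] linear_scale[OF nf(2)]
        linear_scale[OF nf(3)] qq pq0 qp0 algebra_simps)
qed

lemma nabla_endo_zeroI: "x \<in> S \<Longrightarrow> (\<And>w. nabla_form x u v w = 0) \<Longrightarrow> nabla_endo g P x u v = 0"
  by (rule metric_nondegenerate) (auto simp: nabla_form_def bilinear_lzero metric_bilinear)

end

section \<open>The Levi-Civita connection of the cone\<close>

lemma has_derivative_comp_snd:
  assumes "(f has_derivative f') (at x)"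
  shows "((\<lambda>z. f (snd z)) has_derivative (\<lambda>u. f' (snd u))) (at (t, x))"
  using diff_chain_at[OF bounded_linear_imp_has_derivative[OF bounded_linear_snd], of f f' "(t, x)"]
    assms by (simp add: o_def)

lemma cone_metric_eq:
  "cone_metric h i z u w = (fst z)\<^sup>2 * h i (snd z) (snd u) (snd w) + fst u * fst w"
  by (simp add: cone_metric_def case_prod_beta)

lemma cone_phi_eq: "cone_phi P i z u = (0, P i (snd z) (snd u))"
  by (simp add: cone_phi_def case_prod_beta)

lemma cone_xi_eq: "cone_xi i z = (1, 0)"
  by (simp add: cone_xi_def case_prod_beta)

lemma cone_eta_eq: "cone_eta i z u = fst u"
  by (simp add: cone_eta_def case_prod_beta)

lemmas cone_tensor_eqs = cone_metric_eq cone_phi_eq cone_xi_eq cone_eta_eq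

text \<open>
  The warped product connection: the slices \<open>t = const\<close> have second fundamental form \<open>-t h\<close> in the
  direction \<open>d/dt\<close>, and the covariant derivative of \<open>d/dt\<close> along a slice is \<open>1/t\<close> times the identity.
\<close>

definition cone_connection ::
  "('e \<Rightarrow> 'e \<Rightarrow> real) \<Rightarrow> ('e \<Rightarrow> 'e \<Rightarrow> 'e) \<Rightarrow> real \<Rightarrow> real \<times> 'e \<Rightarrow> real \<times> 'e \<Rightarrow> real \<times> 'e::euclidean_space"
  where "cone_connection B \<Gamma> t u v =
    (- t * B (snd u) (snd v),
     \<Gamma> (snd u) (snd v) + (fst u / t) *\<^sub>R snd v + (fst v / t) *\<^sub>R snd u)"

text \<open>The tensor fields are indexed by charts because the cone constructions act on such families.\<close>

locale cone_chart = paracomplex_chart S "h i" "P i"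
  for S :: "'e::euclidean_space set" and h :: "('i, 'e) bilin_field" and P :: "('i, 'e) endo_field"
    and i :: 'i
begin

lemma cone_metric_has_derivative:
  assumes x: "x \<in> S"
  shows "((\<lambda>z. cone_metric h i z v w) has_derivative
    (\<lambda>u. 2 * t * fst u * h i x (snd v) (snd w) +
       t\<^sup>2 * frechet_derivative (\<lambda>y. h i y (snd v) (snd w)) (at x) (snd u))) (at (t, x))"
proof -
  have "((\<lambda>z. h i (snd z) (snd v) (snd w)) has_derivative
    (\<lambda>u. frechet_derivative (\<lambda>y. h i y (snd v) (snd w)) (at x) (snd u))) (at (t, x))"
    by (rule has_derivative_comp_snd[OF metric_has_derivative[OF x]])
  note [derivative_intros] = this
  show ?thesis
    unfolding cone_metric_eq
    by (rule derivative_eq_intros refl | simp)+ (simp add: fun_eq_iff)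
qed

lemma cone_metric_chart: "metric_chart ({0<..} \<times> S) (cone_metric h i)"
proof
  show "open ({0<..} \<times> S :: (real \<times> 'e) set)" using open_chart by (intro open_Times) auto
next
  fix z :: "real \<times> 'e" and v w assume "z \<in> {0<..} \<times> S"
  then obtain t x where z: "z = (t, x)" "t > 0" "x \<in> S" by auto
  note bil = metric_bilinear[OF z(3)]
  show "bilinear (cone_metric h i z)"
    unfolding bilinear_def
    by (intro conjI allI; rule linearI)
       (simp_all add: cone_metric_eq z(1) bilinear_ladd[OF bil] bilinear_lmul[OF bil]
          bilinear_radd[OF bil] bilinear_rmul[OF bil] algebra_simps)
  show "cone_metric h i z v w = cone_metric h i z w v"
    using metric_sym[OF z(3)] z by (simp add: cone_metric_eq mult.commute)
  show "(\<lambda>z. cone_metric h i z v w) differentiable (at z)"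
    using cone_metric_has_derivative[OF z(3)] unfolding z(1) differentiable_def by blast
  assume "v \<noteq> 0"
  show "cone_metric h i z v v > 0"
  proof (cases "snd v = 0")
    case True
    then have "fst v \<noteq> 0" using \<open>v \<noteq> 0\<close> by (simp add: prod_eq_iff)
    then have "fst v * fst v > 0" using not_real_square_gt_zero by blast
    then show ?thesis using True by (simp add: cone_metric_eq z bilinear_lzero[OF bil])
  next
    case False
    then have "t\<^sup>2 * h i x (snd v) (snd v) > 0" using metric_pos[OF z(3)] z(2) by simp
    then show ?thesis by (simp add: cone_metric_eq z add_pos_nonneg)
  qed
qed

lemma levi_civita_cone:
  assumes t: "t > 0" and x: "x \<in> S"
  shows "levi_civita (cone_metric h i) (t, x) = cone_connection (h i x) (levi_civita (h i) x) t"
proof (rule metric_chart.levi_civita_eqI[OF cone_metric_chart])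
  show "(t, x) \<in> {0<..} \<times> S" using assms by simp
  let ?\<Gamma> = "levi_civita (h i) x"
  have bG: "bilinear ?\<Gamma>" and sG: "?\<Gamma> u v = ?\<Gamma> v u"
    and dG: "frechet_derivative (\<lambda>y. h i y v w) (at x) u = h i x (?\<Gamma> u v) w + h i x v (?\<Gamma> u w)" for u v w
    using levi_civita(1)[OF x] unfolding christoffel_at_def by blast+
  note bil = metric_bilinear[OF x]
  note lin = bilinear_ladd[OF bil] bilinear_lmul[OF bil] bilinear_radd[OF bil] bilinear_rmul[OF bil]
    bilinear_ladd[OF bG] bilinear_lmul[OF bG] bilinear_radd[OF bG] bilinear_rmul[OF bG]
  have "bilinear (cone_connection (h i x) ?\<Gamma> t)"
    unfolding bilinear_def
    by (intro conjI allI; rule linearI)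
       (simp_all add: cone_connection_def lin algebra_simps add_divide_distrib)
  moreover have "cone_connection (h i x) ?\<Gamma> t u v = cone_connection (h i x) ?\<Gamma> t v u" for u v
    using metric_sym[OF x, of "snd u" "snd v"] sG[of "snd u" "snd v"] by (simp add: cone_connection_def)
  moreover have "frechet_derivative (\<lambda>z. cone_metric h i z v w) (at (t, x)) u =
      cone_metric h i (t, x) (cone_connection (h i x) ?\<Gamma> t u v) w +
      cone_metric h i (t, x) v (cone_connection (h i x) ?\<Gamma> t u w)" for u v w
    unfolding frechet_derivative_at[OF cone_metric_has_derivative[OF x], symmetric] dG
    using t metric_sym[OF x, of "snd u" "snd v"]
    by (simp add: cone_metric_eq cone_connection_def lin field_simps power2_eq_square)
  ultimately show "christoffel_at (cone_metric h i) (t, x) (cone_connection (h i x) ?\<Gamma> t)"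
    unfolding christoffel_at_def by blast
qed

lemma nabla_endo_cone:
  assumes t: "t > 0" and x: "x \<in> S"
  shows "nabla_endo (cone_metric h i) (cone_phi P i) (t, x) u v =
    (- t * h i x (snd u) (P i x (snd v)),
     nabla_endo (h i) (P i) x (snd u) (snd v) - (fst v / t) *\<^sub>R P i x (snd u))"
proof -
  have "((\<lambda>z. P i (snd z) (snd v)) has_derivative
    (\<lambda>u. frechet_derivative (\<lambda>y. P i y (snd v)) (at x) (snd u))) (at (t, x))"
    by (rule has_derivative_comp_snd[OF P_differentiable[OF x, unfolded frechet_derivative_works]])
  then have "((\<lambda>z. cone_phi P i z v) has_derivative
    (\<lambda>u. (0, frechet_derivative (\<lambda>y. P i y (snd v)) (at x) (snd u)))) (at (t, x))"
    unfolding cone_phi_eq by (intro has_derivative_Pair has_derivative_const)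
  note der = frechet_derivative_at[OF this, symmetric, unfolded cone_phi_eq]
  note lin = linear_add[OF P_linear[OF x]] linear_scale[OF P_linear[OF x]]
  show ?thesis
    by (simp add: nabla_endo_def nabla_def levi_civita_cone[OF assms] der cone_phi_eq
        cone_connection_def lin algebra_simps)
qed

lemma fundamental_tensor_cone:
  assumes t: "t > 0" and x: "x \<in> S"
  shows "fundamental_tensor (cone_phi P) (cone_metric h) i (t, x) u v w =
    t\<^sup>2 * nabla_form x (snd u) (snd v) (snd w)
    - t * (fst v * h i x (P i x (snd u)) (snd w) + fst w * h i x (snd u) (P i x (snd v)))"
  using t metric_bilinear[OF x]
  by (simp add: fundamental_tensor_def nabla_endo_cone[OF assms] cone_metric_eq nabla_form_def
      bilinear_lsub bilinear_lmul algebra_simps power2_eq_square)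

end


section \<open>The fundamental tensor of the cone in a phi-basis\<close>

lemma orthonormal_spans:
  fixes B :: "'e::euclidean_space \<Rightarrow> 'e \<Rightarrow> real"
  assumes B: "bilinear B" and on: "\<And>j k. j < n \<Longrightarrow> k < n \<Longrightarrow> B (e j) (e k) = (if j = k then 1 else 0)"
    and dim: "DIM('e) = n"
  shows "span (e ` {..<n}) = UNIV"
proof -
  have inj: "inj_on e {..<n}"
  proof (rule inj_onI)
    fix j k assume "j \<in> {..<n}" "k \<in> {..<n}" "e j = e k"
    then show "j = k" using on[of j k] on[of j j] by (auto split: if_splits)
  qed
  have "independent (e ` {..<n})"
  proof (rule independent_if_scalars_zero)
    fix f v assume 0: "(\<Sum>v\<in>e ` {..<n}. f v *\<^sub>R v) = 0" and "v \<in> e ` {..<n}"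
    then obtain k where k: "k < n" "v = e k" by auto
    have "0 = B (\<Sum>j<n. f (e j) *\<^sub>R e j) (e k)"
      using 0 by (simp add: sum.reindex[OF inj] bilinear_lzero[OF B])
    also have "\<dots> = (\<Sum>j<n. f (e j) * B (e j) (e k))"
      using B by (subst linear_sum[of "\<lambda>v. B v (e k)"]) (auto simp: bilinear_def bilinear_lmul[OF B])
    also have "\<dots> = (\<Sum>j<n. if j = k then f (e j) else 0)"
      using on k(1) by (intro sum.cong) auto
    also have "\<dots> = f v" using k by simp
    finally show "f v = 0" by simp
  qed simp
  moreover have "card (e ` {..<n}) = n" using inj by (simp add: card_image)
  ultimately show ?thesis
    using card_ge_dim_independent[of "e ` {..<n}" UNIV] dim by auto
qed

lemma sum_lessThan_3: "(\<Sum>k<3::nat. f k) = f 0 + f 1 + (f 2 :: 'b::comm_monoid_add)"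
  by (simp add: numeral_3_eq_3 numeral_2_eq_2)

lemma sum_1_2: "(\<Sum>k=1..2::nat. f k) = f 1 + (f 2 :: 'b::comm_monoid_add)"
  by (simp add: numeral_2_eq_2)

context cone_chart
begin

text \<open>
  The vectors \<open>e\<^sub>1\<close>, \<open>e\<^sub>2\<close> lie in the image of \<open>\<phi>\<close>, hence are tangent to the slice, whose metric is
  \<open>t\<^sup>2 h\<close>.
\<close>

lemma phi_basis_cone:
  assumes t: "t > 0" and x: "x \<in> S"
    and e: "phi_basis (cone_phi P i (t, x)) (cone_xi i (t, x)) (cone_metric h i (t, x)) e"
  obtains p q where "e 0 = (1, 0)" "e 1 = (0, p)" "e 2 = (0, q)" "P i x p = q" "P i x q = p"
    "h i x p p = 1 / t\<^sup>2" "h i x q q = 1 / t\<^sup>2" "h i x p q = 0" "h i x q p = 0"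
proof -
  have e0: "e 0 = (1, 0)" and \<phi>: "cone_phi P i (t, x) (e 1) = e 2" "cone_phi P i (t, x) (e 2) = e 1"
    and on: "\<And>j k. j < 3 \<Longrightarrow> k < 3 \<Longrightarrow> cone_metric h i (t, x) (e j) (e k) = (if j = k then 1 else 0)"
    using e by (simp_all add: phi_basis_def cone_xi_eq)
  have "fst (e 1) = 0" "fst (e 2) = 0"
    using \<phi> by (metis cone_phi_eq fst_conv)+
  then obtain p q where pq: "e 1 = (0, p)" "e 2 = (0, q)" by (metis prod.collapse)
  show ?thesis
    by (rule that[OF e0 pq])
       (use \<phi> on[of 1 1] on[of 2 2] on[of 1 2] on[of 2 1] t in
         \<open>simp_all add: pq cone_phi_eq cone_metric_eq field_simps del: One_nat_def\<close>)
qed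

text \<open>
  The sign in \<open>\<theta>\<^sub>2\<close> comes from moving the component \<open>F\<^sub>2\<^sub>2\<^sub>2 = - F\<^sub>2\<^sub>1\<^sub>1\<close> to the pair \<open>e\<^sub>1, e\<^sub>1\<close>; the two
  summands of \<open>\<theta>\<^sup>*\<^sub>0 = F\<^sub>1\<^sub>2\<^sub>0 + F\<^sub>2\<^sub>1\<^sub>0\<close> are both \<open>- t h(e\<^sub>1, e\<^sub>1) = - 1/t\<close>.
\<close>

lemma theta_cone:
  assumes t: "t > 0" and x: "x \<in> S"
    and e: "phi_basis (cone_phi P i (t, x)) (cone_xi i (t, x)) (cone_metric h i (t, x)) e"
  defines "F \<equiv> fundamental_tensor (cone_phi P) (cone_metric h) i (t, x)"
  shows "theta F e (e 1) = t\<^sup>2 * nabla_form x (snd (e 1)) (snd (e 1)) (snd (e 1))"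
    and "theta F e (e 2) = - t\<^sup>2 * nabla_form x (snd (e 2)) (snd (e 1)) (snd (e 1))"
    and "theta_star F (cone_phi P i (t, x)) e (e 0) = - 2 / t"
proof -
  obtain p q where pq: "e 0 = (1, 0)" "e 1 = (0, p)" "e 2 = (0, q)" "P i x p = q" "P i x q = p"
    "h i x p p = 1 / t\<^sup>2" "h i x q q = 1 / t\<^sup>2" "h i x p q = 0" "h i x q p = 0"
    using phi_basis_cone[OF t x e] .
  note nf = nabla_form_expand[OF x pq(4,5)]
  have n: "nabla_form x u q q = - nabla_form x u p p" "nabla_form x u p q = 0"
    "nabla_form x u q p = 0" for u
    using nf[of u 0 1 0 1] nf[of u 1 0 0 1] nf[of u 0 1 1 0] by simp_all
  have lin: "nabla_form x u 0 w = 0" "nabla_form x u v 0 = 0" "h i x v 0 = 0" "P i x 0 = 0" for u v w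
    using linear_0[OF nabla_form_linear(2)[OF x]] linear_0[OF nabla_form_linear(3)[OF x]]
      bilinear_rzero[OF metric_bilinear[OF x]] linear_0[OF P_linear[OF x]] by simp_all
  show "theta F e (e 1) = t\<^sup>2 * nabla_form x (snd (e 1)) (snd (e 1)) (snd (e 1))"
    "theta F e (e 2) = - t\<^sup>2 * nabla_form x (snd (e 2)) (snd (e 1)) (snd (e 1))"
    "theta_star F (cone_phi P i (t, x)) e (e 0) = - 2 / t"
    unfolding theta_def theta_star_def sum_1_2
    using t
    by (simp_all add: F_def fundamental_tensor_cone[OF t x] cone_phi_eq pq n lin field_simps power2_eq_square
        del: One_nat_def)
qed

text \<open>
  The horizontal part of \<open>F\<close> has a single component in its last two arguments and is the
  \<open>F\<^sup>1\<close>-part; the terms containing \<open>d/dt\<close> pair \<open>e\<^sub>1\<close> with \<open>e\<^sub>2\<close> and are the \<open>F\<^sup>5\<close>-part.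
\<close>

lemma fundamental_tensor_cone_F1_F5:
  assumes t: "t > 0" and x: "x \<in> S"
    and e: "phi_basis (cone_phi P i (t, x)) (cone_xi i (t, x)) (cone_metric h i (t, x)) e"
  defines "F \<equiv> fundamental_tensor (cone_phi P) (cone_metric h) i (t, x)"
  shows "F (\<Sum>k<3. a k *\<^sub>R e k) (\<Sum>k<3. b k *\<^sub>R e k) (\<Sum>k<3. c k *\<^sub>R e k) =
    F1_tensor F (cone_phi P i (t, x)) e a b c + F5_tensor F (cone_phi P i (t, x)) e a b c"
proof -
  obtain p q where pq: "e 0 = (1, 0)" "e 1 = (0, p)" "e 2 = (0, q)" "P i x p = q" "P i x q = p"
    "h i x p p = 1 / t\<^sup>2" "h i x q q = 1 / t\<^sup>2" "h i x p q = 0" "h i x q p = 0"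
    using phi_basis_cone[OF t x e] .
  have coord: "(\<Sum>k<3. a k *\<^sub>R e k) = (a 0, a 1 *\<^sub>R p + a 2 *\<^sub>R q)" for a :: "nat \<Rightarrow> real"
    by (simp add: sum_lessThan_3 pq del: One_nat_def)
  note nf = nabla_form_linear(1)[OF x]
  note bil = metric_bilinear[OF x]
  note lin = bilinear_ladd[OF bil] bilinear_lmul[OF bil] bilinear_radd[OF bil] bilinear_rmul[OF bil]
    linear_add[OF P_linear[OF x]] linear_scale[OF P_linear[OF x]] linear_add[OF nf] linear_scale[OF nf]
  show ?thesis
    unfolding F1_tensor_def F5_tensor_def
    unfolding F_def theta_cone[OF t x e] coord
    using t by (simp add: fundamental_tensor_cone[OF t x] nabla_form_expand[OF x pq(4,5)] lin pq
        field_simps power2_eq_square del: One_nat_def)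
qed

lemma F1_tensor_cone_eq_0I:
  assumes t: "t > 0" and x: "x \<in> S"
    and e: "phi_basis (cone_phi P i (t, x)) (cone_xi i (t, x)) (cone_metric h i (t, x)) e"
    and "\<And>u v. nabla_endo (h i) (P i) x u v = 0"
  shows "F1_tensor (fundamental_tensor (cone_phi P) (cone_metric h) i (t, x))
    (cone_phi P i (t, x)) e a b c = 0"
proof -
  have "nabla_form x u v w = 0" for u v w
    using assms(4) by (simp add: nabla_form_def bilinear_lzero[OF metric_bilinear[OF x]])
  then show ?thesis by (simp add: F1_tensor_def theta_cone[OF t x e] del: One_nat_def)
qed

text \<open>
  Vectors tangent to the slice have no component along \<open>e\<^sub>0\<close>, so \<open>F\<^sup>5\<close> vanishes on them and \<open>F\<close> reduces
  to \<open>t\<^sup>2 h((\<nabla>'\<^sub>u P) v, w)\<close>.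
\<close>

lemma F1_tensor_cone_eq_0D:
  assumes t: "t > 0" and x: "x \<in> S"
    and e: "phi_basis (cone_phi P i (t, x)) (cone_xi i (t, x)) (cone_metric h i (t, x)) e"
  defines "F \<equiv> fundamental_tensor (cone_phi P) (cone_metric h) i (t, x)"
  assumes T1: "\<And>a b c. F1_tensor F (cone_phi P i (t, x)) e a b c = 0"
  shows "nabla_endo (h i) (P i) x u v = 0"
proof (rule nabla_endo_zeroI[OF x])
  fix w
  have coord: "\<exists>a. (\<Sum>k<3. a k *\<^sub>R e k) = (0, u) \<and> a 0 = 0" for u
  proof -
    have "(0, u) \<in> span (e ` {..<3})" using e by (simp add: phi_basis_def)
    moreover have "e ` {..<3} = {e 0, e 1, e 2}"
      by (auto simp: numeral_3_eq_3 numeral_2_eq_2 lessThan_Suc)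
    ultimately obtain r s q where "(0, u) - r *\<^sub>R e 0 - s *\<^sub>R e 1 = q *\<^sub>R e 2"
      by (auto simp: span_breakdown_eq span_singleton)
    then have eq: "r *\<^sub>R e 0 + s *\<^sub>R e 1 + q *\<^sub>R e 2 = (0, u)" by (simp add: algebra_simps)
    define a where "a k = (if k = 0 then r else if k = 1 then s else q)" for k :: nat
    have va: "(\<Sum>k<3. a k *\<^sub>R e k) = (0, u)" using eq by (simp add: sum_lessThan_3 a_def)
    have "fst (e 0) = 1" "fst (e 1) = 0" "fst (e 2) = 0"
      using phi_basis_cone[OF t x e] by (metis fst_conv)+
    then have "r = 0" using arg_cong[OF eq, of fst] by simp
    then show ?thesis using va by (auto simp: a_def)
  qed
  obtain a where a: "(\<Sum>k<3. a k *\<^sub>R e k) = (0, u)" using coord[of u] by blast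
  obtain b where b: "(\<Sum>k<3. b k *\<^sub>R e k) = (0, v)" "b 0 = 0" using coord[of v] by blast
  obtain c where c: "(\<Sum>k<3. c k *\<^sub>R e k) = (0, w)" "c 0 = 0" using coord[of w] by blast
  have "F (0, u) (0, v) (0, w) = F5_tensor F (cone_phi P i (t, x)) e a b c"
    using fundamental_tensor_cone_F1_F5[OF t x e, of a b c] T1
    unfolding a b(1) c(1) F_def by simp
  also have "\<dots> = 0" by (simp add: F5_tensor_def b(2) c(2))
  finally show "nabla_form x u v w = 0"
    using t by (simp add: F_def fundamental_tensor_cone[OF t x])
qed

text \<open>
  If \<open>a\<close> and \<open>b\<close> are eigenvectors of \<open>P\<close> for \<open>1\<close> and \<open>-1\<close>, they are orthogonal, and after
  normalisation \<open>P\<close> exchanges \<open>a + b\<close> and \<open>a - b\<close>, which are again orthogonal.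
\<close>

lemma phi_basis_cone_exists:
  assumes t: "t > 0" and x: "x \<in> S" and dim: "DIM('e) = 2"
    and P: "P i x \<noteq> id" "trace_endo (P i x) = 0"
  shows "\<exists>e. phi_basis (cone_phi P i (t, x)) (cone_xi i (t, x)) (cone_metric h i (t, x)) e"
proof -
  note bil = metric_bilinear[OF x]
  note lin = bilinear_ladd[OF bil] bilinear_lmul[OF bil] bilinear_radd[OF bil] bilinear_rmul[OF bil]
    bilinear_lsub[OF bil] bilinear_rsub[OF bil] bilinear_lneg[OF bil] bilinear_rneg[OF bil]
    linear_add[OF P_linear[OF x]] linear_scale[OF P_linear[OF x]] linear_diff[OF P_linear[OF x]]
  obtain b where b: "b \<noteq> 0" "P i x b = - b"
  proof -
    obtain v where "P i x v \<noteq> v" using P(1) by (metis eq_id_iff)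
    then show ?thesis using that[of "v - P i x v"] by (simp add: lin P_P[OF x])
  qed
  \<comment> \<open>Without an eigenvector for \<open>1\<close>, \<open>P\<close> would be \<open>- id\<close>, whose trace is not zero.\<close>
  obtain a where a: "a \<noteq> 0" "P i x a = a"
  proof -
    have "\<exists>v. P i x v \<noteq> - v"
    proof (rule ccontr)
      assume "\<not> (\<exists>v. P i x v \<noteq> - v)"
      then have "trace_endo (P i x) = - real DIM('e)" by (simp add: trace_endo_def sum_negf)
      then show False using P(2) dim by simp
    qed
    then obtain v where "P i x v \<noteq> - v" by blast
    then show ?thesis using that[of "v + P i x v"]
      by (simp add: lin P_P[OF x] add.commute eq_neg_iff_add_eq_0)
  qed
  have ab: "h i x a b = 0" "h i x b a = 0"
    using P_isometry[OF x, of a b] metric_sym[OF x, of a b] a(2) b(2) lin by auto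
  have pos: "h i x a a > 0" "h i x b b > 0" using metric_pos[OF x] a b by auto
  \<comment> \<open>Both scaled vectors get length \<open>1 / sqrt 2\<close> in the slice metric \<open>t\<^sup>2 h\<close>.\<close>
  define r s where "r = 1 / (t * sqrt (2 * h i x a a))" and "s = 1 / (t * sqrt (2 * h i x b b))"
  have "t\<^sup>2 * (r * r * h i x a a) = 1/2" "t\<^sup>2 * (s * s * h i x b b) = 1/2"
    using pos t by (simp_all add: r_def s_def power2_eq_square)
  then have rs: "r * (r * h i x a a) = 1 / (2 * t\<^sup>2)" "s * (s * h i x b b) = 1 / (2 * t\<^sup>2)"
    using t by (simp_all add: field_simps)
  define p q where "p = r *\<^sub>R a + s *\<^sub>R b" and "q = r *\<^sub>R a - s *\<^sub>R b"
  have Ppq: "P i x p = q" "P i x q = p" by (simp_all add: p_def q_def lin a b)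
  have pq: "t\<^sup>2 * h i x p p = 1" "t\<^sup>2 * h i x q q = 1" "h i x p q = 0" "h i x q p = 0"
    using rs t by (simp_all add: p_def q_def lin ab rs field_simps)
  define e where "e k = (if k = 0 then (1 :: real, 0) else if k = 1 then (0, p) else (0, q))" for k :: nat
  have tx: "(t, x) \<in> {0<..} \<times> S" using t x by simp
  have on: "cone_metric h i (t, x) (e j) (e k) = (if j = k then 1 else 0)" if "j < 3" "k < 3" for j k
  proof -
    have "j \<in> {0, 1, 2}" "k \<in> {0, 1, 2}" using that by auto
    then show ?thesis
      by (auto simp: cone_metric_eq e_def pq bilinear_lzero[OF bil] bilinear_rzero[OF bil])
  qed
  have "span (e ` {..<3}) = UNIV"
    by (rule orthonormal_spans[OF metric_chart.metric_bilinear[OF cone_metric_chart tx]]) (use on dim in auto)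
  then have "phi_basis (cone_phi P i (t, x)) (cone_xi i (t, x)) (cone_metric h i (t, x)) e"
    using on linear_0[OF P_linear[OF x]]
    by (auto simp: phi_basis_def cone_phi_eq cone_xi_eq) (simp_all add: e_def Ppq zero_prod_def)
  then show ?thesis by (intro exI[of _ e])
qed

end


section \<open>The cone as an almost paracontact almost paracomplex Riemannian manifold\<close>

lemma cone_manifold_sel [simp]:
  "Idx (cone_manifold N) = Idx N"
  "Dom (cone_manifold N) i = {0<..} \<times> Dom N i"
  "Crd (cone_manifold N) i z = (fst z, Crd N i (snd z))"
  by (simp_all add: cone_manifold_def case_prod_beta)

lemma Img_cone: "Img (cone_manifold N) i = {0<..} \<times> Img N i"
  unfolding Img_def by (auto simp: image_iff)

lemma Overlap_cone: "Overlap (cone_manifold N) i j = {0<..} \<times> Overlap N i j"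
  unfolding Overlap_def by (auto simp: image_iff) force

context
  fixes N :: "('i, 'a::{t2_space,second_countable_topology}, 'e::euclidean_space) manifold"
  assumes N: "smooth_manifold N"
begin

lemma Crd_homeomorphism:
  "i \<in> Idx N \<Longrightarrow> homeomorphism (Dom N i) (Img N i) (Crd N i) (inv_into (Dom N i) (Crd N i))"
  using N by (simp add: smooth_manifold_def)

lemma inv_Crd_cone:
  assumes i: "i \<in> Idx N" and z: "z \<in> {0<..} \<times> Img N i"
  shows "inv_into ({0<..} \<times> Dom N i) (Crd (cone_manifold N) i) z =
    (fst z, inv_into (Dom N i) (Crd N i) (snd z))"
proof (rule inv_into_f_eq)
  have inj: "inj_on (Crd N i) (Dom N i)"
    using homeomorphism_apply1[OF Crd_homeomorphism[OF i]] by (rule inj_on_inverseI)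
  then show "inj_on (Crd (cone_manifold N) i) ({0<..} \<times> Dom N i)"
    by (auto simp: inj_on_def)
  have "snd z \<in> Crd N i ` Dom N i" using z by (auto simp: Img_def)
  then show "(fst z, inv_into (Dom N i) (Crd N i) (snd z)) \<in> {0<..} \<times> Dom N i"
    "Crd (cone_manifold N) i (fst z, inv_into (Dom N i) (Crd N i) (snd z)) = z"
    using z by (auto intro: inv_into_into simp: f_inv_into_f)
qed

lemma Overlap_subset_Img: "Overlap N i j \<subseteq> Img N i"
  by (auto simp: Overlap_def Img_def)

lemma transition_cone:
  assumes i: "i \<in> Idx N" and z: "z \<in> {0<..} \<times> Overlap N i j"
  shows "transition (cone_manifold N) i j z = (fst z, transition N i j (snd z))"
proof -
  have "z \<in> {0<..} \<times> Img N i" using z Overlap_subset_Img by auto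
  then show ?thesis by (simp add: transition_def inv_Crd_cone[OF i])
qed

lemma smooth_transition:
  "i \<in> Idx N \<Longrightarrow> j \<in> Idx N \<Longrightarrow> smooth_on (Overlap N i j) (transition N i j)"
  using N by (simp add: smooth_manifold_def)

lemma dtransition_cone:
  assumes i: "i \<in> Idx N" "j \<in> Idx N" and z: "t > 0" "x \<in> Overlap N i j"
  shows "dtransition (cone_manifold N) i j (t, x) u = (fst u, dtransition N i j x (snd u))"
proof -
  have op: "open ({0<..} \<times> Overlap N i j :: (real \<times> 'e) set)"
    using smooth_transition[OF i] by (intro open_Times) (auto simp: smooth_on_def)
  have "(transition N i j has_derivative dtransition N i j x) (at x)"
    using smooth_on_imp_differentiable[OF smooth_transition[OF i] z(2)] unfolding frechet_derivative_works .
  then have "((\<lambda>z. (fst z, transition N i j (snd z))) has_derivative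
      (\<lambda>u. (fst u, dtransition N i j x (snd u)))) (at (t, x))"
    by (intro has_derivative_Pair has_derivative_comp_snd has_derivative_fst has_derivative_ident)
  then have "(transition (cone_manifold N) i j has_derivative
      (\<lambda>u. (fst u, dtransition N i j x (snd u)))) (at (t, x))"
    by (rule has_derivative_transform_within_open[OF _ op])
       (use z in \<open>simp_all add: transition_cone[OF i(1)]\<close>)
  from frechet_derivative_at[OF this, symmetric] show ?thesis by simp
qed

text \<open>The transition maps are \<open>id \<times> \<tau>\<close>, written as a sum to separate the two factors.\<close>

lemma smooth_manifold_cone: "smooth_manifold (cone_manifold N)"
  unfolding smooth_manifold_def cone_manifold_sel(1)
proof (intro conjI ballI)
  obtain p where "p \<in> carrier N" using N by (auto simp: smooth_manifold_def)
  then have "(1, p) \<in> carrier (cone_manifold N)" by (auto simp: carrier_def)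
  then show "carrier (cone_manifold N) \<noteq> {}" by blast
next
  fix i assume i: "i \<in> Idx N"
  have op: "open (Dom N i)" "open (Img N i)" using N i by (auto simp: smooth_manifold_def)
  then show "open (Dom (cone_manifold N) i)" "open (Img (cone_manifold N) i)"
    unfolding Img_cone cone_manifold_sel by (auto intro: open_Times)
  let ?f = "Crd N i" and ?g = "inv_into (Dom N i) (Crd N i)"
  note h = Crd_homeomorphism[OF i]
  have "homeomorphism ({0<..} \<times> Dom N i) ({0<..} \<times> Img N i)
    (\<lambda>z. (fst z, ?f (snd z))) (\<lambda>z. (fst z, ?g (snd z)) :: real \<times> 'a)"
  proof (rule homeomorphismI)
    show "continuous_on ({0<..} \<times> Dom N i) (\<lambda>z. (fst z, ?f (snd z)))"
      by (intro continuous_intros continuous_on_compose2[OF homeomorphism_cont1[OF h]]) auto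
    show "continuous_on ({0<..} \<times> Img N i) (\<lambda>z. (fst z, ?g (snd z)))"
      by (intro continuous_intros continuous_on_compose2[OF homeomorphism_cont2[OF h]]) auto
  qed (use homeomorphism_image1[OF h] homeomorphism_image2[OF h] homeomorphism_apply1[OF h]
      homeomorphism_apply2[OF h] in auto)
  then show "homeomorphism (Dom (cone_manifold N) i) (Img (cone_manifold N) i)
      (Crd (cone_manifold N) i) (inv_into (Dom (cone_manifold N) i) (Crd (cone_manifold N) i))"
    by (rule homeomorphism_cong) (auto simp: Img_cone inv_Crd_cone[OF i])
next
  fix i j assume ij: "i \<in> Idx N" "j \<in> Idx N"
  let ?O = "{0<..} \<times> Overlap N i j :: (real \<times> 'e) set"
  have op: "open ?O"
    using smooth_transition[OF ij] by (intro open_Times) (auto simp: smooth_on_def)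
  have 1: "bounded_linear (\<lambda>z :: real \<times> 'e. (fst z, 0 :: 'e))" "bounded_linear (\<lambda>y :: 'e. (0 :: real, y))"
    by (intro bounded_linear_Pair bounded_linear_fst bounded_linear_zero bounded_linear_ident)+
  have "smooth_on ?O (\<lambda>z. transition N i j (snd z))"
    by (rule smooth_on_snd[OF smooth_transition[OF ij]]) simp
  then have "smooth_on ?O (\<lambda>z. (fst z, 0) + (0, transition N i j (snd z)))"
    by (intro smooth_on_add smooth_on_bounded_linear[OF 1(1) op] smooth_on_compose_linear[OF _ 1(2)])
  then show "smooth_on (Overlap (cone_manifold N) i j) (transition (cone_manifold N) i j)"
    unfolding Overlap_cone by (rule smooth_on_cong) (simp add: transition_cone[OF ij(1)])
qed

end

lemma cone_chart_of_paracomplex: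
  assumes N: "almost_paracomplex_riemannian N P h" and i: "i \<in> Idx N"
  shows "cone_chart (Img N i) h P i"
proof -
  have *: "smooth_manifold N" "endomorphism_field N P" "riemannian_metric N h"
    "\<And>x v. x \<in> Img N i \<Longrightarrow> P i x (P i x v) = v"
    "\<And>x v w. x \<in> Img N i \<Longrightarrow> h i x (P i x v) (P i x w) = h i x v w"
    using N i unfolding almost_paracomplex_riemannian_def by blast+
  have "open (Img N i)" using *(1) i by (simp add: smooth_manifold_def)
  moreover have "bilinear (h i x)" "h i x v w = h i x w v" "v \<noteq> 0 \<Longrightarrow> 0 < h i x v v"
    "(\<lambda>y. h i y v w) differentiable (at x)" if "x \<in> Img N i" for x v w
    using *(3) i that smooth_on_imp_differentiable[OF _ that, of "\<lambda>y. h i y v w"]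
    unfolding riemannian_metric_def by blast+
  moreover have "linear (P i x)" "(\<lambda>y. P i y v) differentiable (at x)" if "x \<in> Img N i" for x v
    using *(2) i that smooth_on_imp_differentiable[OF _ that, of "\<lambda>y. P i y v"]
    unfolding endomorphism_field_def by blast+
  ultimately show ?thesis
    using *(4,5)
    by (intro cone_chart.intro paracomplex_chart.intro metric_chart.intro paracomplex_chart_axioms.intro) auto
qed

lemma trace_endo_prod:
  fixes f :: "real \<times> 'e::euclidean_space \<Rightarrow> real \<times> 'e"
  shows "trace_endo f = fst (f (1, 0)) + trace_endo (\<lambda>y. snd (f (0, y)))"
  unfolding trace_endo_def Basis_prod_def
  by (subst sum.union_disjoint) (auto simp: sum.reindex inj_on_def inner_prod_def)

text \<open>
  Changes of product charts fix \<open>d/dt\<close> and act on the slice by the changes of charts of \<open>N\<close>, so each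
  transformation law reduces to the one on \<open>N\<close>.
\<close>

lemma apapR_cone:
  fixes N :: "('i, 'a::{t2_space,second_countable_topology}, 'e::euclidean_space) manifold"
  assumes N: "almost_paracomplex_riemannian N P h"
  shows "apapR (cone_manifold N) (cone_phi P) cone_xi cone_eta (cone_metric h)"
proof -
  have man: "smooth_manifold N" and dim: "even DIM('e)" and endo: "endomorphism_field N P"
    and met: "riemannian_metric N h"
    and tr: "\<And>i x. i \<in> Idx N \<Longrightarrow> x \<in> Img N i \<Longrightarrow> trace_endo (P i x) = 0"
    and PP: "\<And>i x v. i \<in> Idx N \<Longrightarrow> x \<in> Img N i \<Longrightarrow> P i x (P i x v) = v"
    and iso: "\<And>i x v w. i \<in> Idx N \<Longrightarrow> x \<in> Img N i \<Longrightarrow> h i x (P i x v) (P i x w) = h i x v w"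
    using N unfolding almost_paracomplex_riemannian_def by blast+
  note tc = transition_cone[OF man] and dtc = dtransition_cone[OF man]
  have op: "open ({0<..} \<times> Img N i :: (real \<times> 'e) set)" if "i \<in> Idx N" for i
    using man that by (intro open_Times) (auto simp: smooth_manifold_def)
  have der0: "dtransition N i j x 0 = 0" if "i \<in> Idx N" "j \<in> Idx N" "x \<in> Overlap N i j" for i j x
    using linear_0[OF linear_frechet_derivative]
      smooth_on_imp_differentiable[OF smooth_transition[OF man that(1,2)] that(3)] by blast
  have sm_fst: "smooth_on ({0<..} \<times> Img N i) (fst :: real \<times> 'e \<Rightarrow> real)" if "i \<in> Idx N" for i
    by (intro smooth_on_bounded_linear bounded_linear_fst op that)
  have 1: "endomorphism_field (cone_manifold N) (cone_phi P)"
    unfolding endomorphism_field_def cone_manifold_sel(1) Img_cone Overlap_cone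
  proof (intro conjI ballI allI)
    fix i and z :: "real \<times> 'e" assume "i \<in> Idx N" "z \<in> {0<..} \<times> Img N i"
    then have "linear (P i (snd z))" using endo by (auto simp: endomorphism_field_def)
    then show "linear (cone_phi P i z)"
      by (intro linearI) (simp_all add: cone_phi_eq linear_add linear_scale)
  next
    fix i and v :: "real \<times> 'e" assume i: "i \<in> Idx N"
    have "smooth_on (Img N i) (\<lambda>x. P i x (snd v))" using endo i by (auto simp: endomorphism_field_def)
    then show "smooth_on ({0<..} \<times> Img N i) (\<lambda>z. cone_phi P i z v)"
      unfolding cone_phi_eq
      by (intro smooth_on_compose_linear[where L = "\<lambda>y. (0, y)"] smooth_on_snd bounded_linear_intros) auto
  next
    fix i j and z v :: "real \<times> 'e"
    assume ij: "i \<in> Idx N" "j \<in> Idx N" and z: "z \<in> {0<..} \<times> Overlap N i j"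
    then show "cone_phi P j (transition (cone_manifold N) i j z) (dtransition (cone_manifold N) i j z v) =
        dtransition (cone_manifold N) i j z (cone_phi P i z v)"
      using endo by (cases z) (auto simp: endomorphism_field_def cone_phi_eq tc dtc)
  qed
  have 2: "vector_field (cone_manifold N) cone_xi"
    unfolding vector_field_def cone_manifold_sel(1) Img_cone Overlap_cone cone_xi_eq[abs_def]
    by (auto simp: dtc der0 intro!: smooth_on_const op)
  have 3: "one_form_field (cone_manifold N) cone_eta"
    unfolding one_form_field_def cone_manifold_sel(1) Img_cone Overlap_cone cone_eta_eq[abs_def]
    by (auto simp: dtc intro!: smooth_on_const op linear_fst)
  have 4: "riemannian_metric (cone_manifold N) (cone_metric h)"
    unfolding riemannian_metric_def cone_manifold_sel(1) Img_cone Overlap_cone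
  proof (intro conjI ballI allI impI)
    fix i and z :: "real \<times> 'e" assume i: "i \<in> Idx N" and z: "z \<in> {0<..} \<times> Img N i"
    note cone = cone_chart.cone_metric_chart[OF cone_chart_of_paracomplex[OF N i]]
    show "bilinear (cone_metric h i z)" by (rule metric_chart.metric_bilinear[OF cone z])
    show "cone_metric h i z v w = cone_metric h i z w v" for v w
      by (rule metric_chart.metric_sym[OF cone z])
    show "0 < cone_metric h i z v v" if "v \<noteq> 0" for v
      by (rule metric_chart.metric_pos[OF cone z that])
  next
    fix i and v w :: "real \<times> 'e" assume i: "i \<in> Idx N"
    have "smooth_on (Img N i) (\<lambda>x. h i x (snd v) (snd w))" using met i by (auto simp: riemannian_metric_def)
    then show "smooth_on ({0<..} \<times> Img N i) (\<lambda>z. cone_metric h i z v w)"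
      unfolding cone_metric_eq power2_eq_square
      by (intro smooth_on_add smooth_on_mult sm_fst i smooth_on_snd smooth_on_const op) auto
  next
    fix i j and z v w :: "real \<times> 'e"
    assume ij: "i \<in> Idx N" "j \<in> Idx N" and z: "z \<in> {0<..} \<times> Overlap N i j"
    then show "cone_metric h j (transition (cone_manifold N) i j z)
        (dtransition (cone_manifold N) i j z v) (dtransition (cone_manifold N) i j z w) =
        cone_metric h i z v w"
      using met by (cases z) (auto simp: riemannian_metric_def cone_metric_eq tc dtc)
  qed
  show ?thesis
    unfolding apapR_def cone_manifold_sel(1) Img_cone
  proof (intro conjI ballI allI 1 2 3 4 smooth_manifold_cone[OF man])
    show "odd DIM(real \<times> 'e)" using dim by simp
  next
    fix i and z :: "real \<times> 'e" assume i: "i \<in> Idx N" and z: "z \<in> {0<..} \<times> Img N i"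
    then have x: "snd z \<in> Img N i" by auto
    have P0: "P i (snd z) 0 = 0"
      using endo i x by (auto simp: endomorphism_field_def linear_0)
    show "trace_endo (cone_phi P i z) = 0"
      using tr[OF i x] by (simp add: trace_endo_prod cone_phi_eq)
    show "cone_phi P i z (cone_phi P i z v) = v - cone_eta i z v *\<^sub>R cone_xi i z" for v
      using PP[OF i x] by (simp add: cone_tensor_eqs prod_eq_iff)
    show "cone_metric h i z (cone_phi P i z v) (cone_phi P i z w) =
        cone_metric h i z v w - cone_eta i z v * cone_eta i z w" for v w
      using iso[OF i x] by (simp add: cone_tensor_eqs)
    show "cone_phi P i z (cone_xi i z) = 0"
      using P0 by (simp add: cone_tensor_eqs zero_prod_def)
  qed (simp_all add: cone_tensor_eqs)
qed

section \<open>The classes of the cone\<close>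

theorem theorem2p2:
  fixes N :: "('i, 'a::{t2_space,second_countable_topology}, 'e::euclidean_space) manifold"
    and P :: "('i, 'e) endo_field"
    and h :: "('i, 'e) bilin_field"
  assumes "almost_paracomplex_riemannian N P h"
    and "DIM('e) = 2"
  shows "class_F1_F5 (cone_manifold N) (cone_phi P) cone_xi cone_eta (cone_metric h)
     \<and> (class_F5 (cone_manifold N) (cone_phi P) cone_xi cone_eta (cone_metric h) \<longleftrightarrow> W0_manifold N P h)
     \<and> \<not> class_F1 (cone_manifold N) (cone_phi P) cone_xi cone_eta (cone_metric h)"
proof -
  note N = assms(1)
  let ?F = "\<lambda>i z. fundamental_tensor (cone_phi P) (cone_metric h) i z"
  let ?basis = "\<lambda>i z. phi_basis (cone_phi P i z) (cone_xi i z) (cone_metric h i z)"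
  let ?T1 = "\<lambda>i z e. F1_tensor (?F i z) (cone_phi P i z) e"
  let ?T5 = "\<lambda>i z e. F5_tensor (?F i z) (cone_phi P i z) e"
  let ?v = "\<lambda>e a. \<Sum>k<3. a k *\<^sub>R e k :: real \<times> 'e"
  have chart: "cone_chart (Img N i) h P i" if "i \<in> Idx N" for i
    using cone_chart_of_paracomplex[OF N that] .
  have F15: "?F i (t, x) (?v e a) (?v e b) (?v e c) = ?T1 i (t, x) e a b c + ?T5 i (t, x) e a b c"
    if "i \<in> Idx N" "t > 0" "x \<in> Img N i" "?basis i (t, x) e" for i t x e a b c
    by (rule cone_chart.fundamental_tensor_cone_F1_F5[OF chart that(2-4)]) (rule that(1))
  have basis: "\<exists>e. ?basis i (t, x) e" if "i \<in> Idx N" "t > 0" "x \<in> Img N i" for i t x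
    using N assms(2) that unfolding almost_paracomplex_riemannian_def
    by (intro cone_chart.phi_basis_cone_exists[OF chart]) auto
  have in_classD: "?T1 i (t, x) e a b c + ?T5 i (t, x) e a b c =
      T (?F i (t, x)) (cone_phi P i (t, x)) e a b c"
    if T: "in_class T (cone_manifold N) (cone_phi P) cone_xi cone_eta (cone_metric h)"
      and *: "i \<in> Idx N" "t > 0" "x \<in> Img N i" "?basis i (t, x) e" for T i t x e a b c
  proof -
    have "(t, x) \<in> Img (cone_manifold N) i" using * by (simp add: Img_cone)
    then have "?F i (t, x) (?v e a) (?v e b) (?v e c) = T (?F i (t, x)) (cone_phi P i (t, x)) e a b c"
      using T * unfolding in_class_def cone_manifold_sel(1) by blast
    then show ?thesis using F15[OF *] by simp
  qed
  have in_classI: "in_class T (cone_manifold N) (cone_phi P) cone_xi cone_eta (cone_metric h)"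
    if T: "\<And>i t x e a b c. i \<in> Idx N \<Longrightarrow> t > 0 \<Longrightarrow> x \<in> Img N i \<Longrightarrow> ?basis i (t, x) e \<Longrightarrow>
      ?T1 i (t, x) e a b c + ?T5 i (t, x) e a b c = T (?F i (t, x)) (cone_phi P i (t, x)) e a b c" for T
    unfolding in_class_def cone_manifold_sel(1) Img_cone
  proof (intro conjI ballI allI impI apapR_cone[OF N])
    show "DIM(real \<times> 'e) = 3" using assms(2) by simp
    fix i z e a b c assume i: "i \<in> Idx N" and "z \<in> {0<..} \<times> Img N i" and e: "?basis i z e"
    then obtain t x where z: "z = (t, x)" "t > 0" "x \<in> Img N i" by auto
    note * = i z(2,3) e[unfolded z(1)]
    show "?F i z (?v e a) (?v e b) (?v e c) = T (?F i z) (cone_phi P i z) e a b c"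
      unfolding z(1) F15[OF *] by (rule T[OF *])
  qed
  have theta_star: "theta_star (?F i (t, x)) (cone_phi P i (t, x)) e (e 0) = - 2 / t"
    if "i \<in> Idx N" "t > 0" "x \<in> Img N i" "?basis i (t, x) e" for i t x e
    by (rule cone_chart.theta_cone(3)[OF chart that(2-4)]) (rule that(1))

  have "class_F1_F5 (cone_manifold N) (cone_phi P) cone_xi cone_eta (cone_metric h)"
    unfolding class_F1_F5_def by (rule in_classI) (rule refl)
  moreover
  have "\<not> class_F1 (cone_manifold N) (cone_phi P) cone_xi cone_eta (cone_metric h)"
  proof
    assume F1: "class_F1 (cone_manifold N) (cone_phi P) cone_xi cone_eta (cone_metric h)"
    have "carrier N \<noteq> {}" using N by (simp add: almost_paracomplex_riemannian_def smooth_manifold_def)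
    then obtain i x where ix: "i \<in> Idx N" "x \<in> Img N i" by (auto simp: carrier_def Img_def)
    then obtain e where e: "?basis i (1, x) e" using basis[of i 1 x] by auto
    define d :: "nat \<Rightarrow> nat \<Rightarrow> real" where "d j k = (if k = j then 1 else 0)" for j k
    \<comment> \<open>The component \<open>F\<^sub>1\<^sub>2\<^sub>0\<close>, where \<open>F\<^sup>5\<close> takes the value \<open>\<theta>\<^sup>*\<^sub>0 / 2 = - 1/t\<close>.\<close>
    have "?T5 i (1, x) e (d 1) (d 2) (d 0) = 0"
      using in_classD[OF F1[unfolded class_F1_def] ix(1) zero_less_one ix(2) e] by (metis add_cancel_right_right)
    then show False
      using theta_star[OF ix(1) _ ix(2) e] by (simp add: F5_tensor_def d_def)
  qed
  moreover
  have "class_F5 (cone_manifold N) (cone_phi P) cone_xi cone_eta (cone_metric h) \<longleftrightarrow> W0_manifold N P h"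
  proof
    assume F5: "class_F5 (cone_manifold N) (cone_phi P) cone_xi cone_eta (cone_metric h)"
    have "nabla_endo (h i) (P i) x u v = 0" if i: "i \<in> Idx N" and x: "x \<in> Img N i" for i x u v
    proof -
      obtain e where e: "?basis i (1, x) e" using basis[OF i _ x, of 1] by auto
      have "?T1 i (1, x) e a b c = 0" for a b c
        using in_classD[OF F5[unfolded class_F5_def] i zero_less_one x e, of a b c] by simp
      then show ?thesis
        by (rule cone_chart.F1_tensor_cone_eq_0D[OF chart[OF i] zero_less_one x e])
    qed
    then show "W0_manifold N P h" using N by (simp add: W0_manifold_def)
  next
    assume W0: "W0_manifold N P h"
    have "?T1 i (t, x) e a b c = 0"
      if i: "i \<in> Idx N" and t: "t > 0" and x: "x \<in> Img N i" and e: "?basis i (t, x) e" for i t x e a b c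
      using W0 i x unfolding W0_manifold_def
      by (intro cone_chart.F1_tensor_cone_eq_0I[OF chart[OF i] t x e]) blast
    then show "class_F5 (cone_manifold N) (cone_phi P) cone_xi cone_eta (cone_metric h)"
      unfolding class_F5_def by (intro in_classI) simp
  qed
  ultimately show ?thesis by blast
qed

end
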